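(* Let $n\geqslant4$ and $m=\lfloor\frac{n-1}{2}\rfloor$. Let $D'=\{g,e_1,x_1,\ldots,x_m\}$ be an alphabet (of $2+m$ letters) and let $Q'$ consist of the following $\frac12\bigl(3n^2-(3+(-1)^n)n+5-\frac{1+(-1)^n}{2}\bigr)$ monoid relations on $D'^*$ (counted as a list indexed by the parameters shown): $(Q'_1)$ $g^n=1$; $(Q'_2)$ $e_1^2=e_1$; $(Q'_3)$ $e_1g^{n-j+i}e_1g^{n-i+j}=g^{n-j+i}e_1g^{n-i+j}e_1$, for $1\leqslant i<j\leqslant n$; $(Q'_5)$ $g(e_1g^{n-1})^n=(e_1g^{n-1})^n$; $(Q'_6)$ $e_1x_i=x_ie_1=g^{n-2i}(e_1g^{n-1})^{n-i-1}e_1g^{n-2}(e_1g^{n-1})^{i-1}$, for $1\leqslant i\leqslant m$; $(Q'_7)$ $x_ig^{n-j+1}e_1g^{j-1}=x_i$, for $1\leqslant i\leqslant m$, $2\leqslant j\leqslant n$, $j\neq n-i+1$; $(Q'_8)$ $g^{n-j+1}e_1g^{j-1}x_i=x_i$, for $1\leqslant i\leqslant m$, $2\leqslant j\leqslant n$, $j\neq i+1$; $(Q'_9)$ $x_ig^ie_1g^{n-i}=g^{n-i}e_1g^ix_i=g^{n-1}(e_1g^{n-1})^{n-1}$, for $1\leqslant i\leqslant m$; $(Q'_{10})$ $(x_1g)^2=g^{n-2}(e_1g^{n-1})^{n-2}$; $(x_ig^i)^2=g^{n-1}(e_1g^{n-1})^{i-2}e_1g^{n-2}(e_1g^{n-1})^{n-i-1}$,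 for $2\leqslant i\leqslant m$. Then the monoid $\mathcal{OPDI}_n$ is defined by the presentation $\langle D'\mid Q'\rangle$.
   Context: Let $\Omega_n=\{1<2<\cdots<n\}$. $\mathcal{I}_n$ is the symmetric inverse monoid of all partial permutations (injective partial maps) of $\Omega_n$ under composition; maps act on the right, so $\alpha\beta$ means first $\alpha$, then $\beta$. Let $g$ be the permutation $i\mapsto i+1$ ($1\leqslant i\leqslant n-1$), $n\mapsto 1$, and $h$ the permutation $i\mapsto n+1-i$; they generate the dihedral group $\mathcal{D}_{2n}$ of order $2n$ inside the symmetric group on $\Omega_n$. The dihedral inverse monoid $\mathcal{DI}_n$ is the submonoid of $\mathcal{I}_n$ of all restrictions (to arbitrary subsets of $\Omega_n$) of elements of $\mathcal{D}_{2n}$. A sequence $(a_1,\ldots,a_t)$ ($t\geqslant0$) in $\Omega_n$ is cyclic if there is at most one index $i\in\{1,\ldots,t\}$ with $a_i>a_{i+1}$, where $a_{t+1}$ denotes $a_1$. An $\alpha\in\mathcal{I}_n$ with $\mathrm{Dom}(\alpha)=\{a_1<\cdots<a_t\}$ is orientation-preserving if $(a_1\alpha,\ldots,a_t\alpha)$ is cyclic. $\mathcal{OPDI}_n$ is the monoid of all orientation-preserving elements of $\mathcal{DI}_n$. A monoid $M$ is defined by a presentation $\langle D'\mid Q'\rangle$, where $Q'\subseteq D'^*\times D'^*$, if $M\cong D'^*/\rho$, where $\rho$ is the smallest congruence on the free monoid $D'^*$ containing $Q'$. Conventions: $1$ denotes the empty word, and $u^0=1$. A chain of $k$ equalities counts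 as $k$ relations, and relations are counted once per value of the index parameters (so coinciding relations with different indices are counted separately). *)

theory Defs
  imports Complex_Main "HOL-Algebra.Sym_Groups"
begin

section \<open>Monoid presentations\<close>

definition free_monoid :: "'a set \<Rightarrow> 'a list monoid" where
  "free_monoid A = \<lparr>carrier = lists A, mult = (@), one = []\<rparr>"

definition monoid_congruence :: "('a, 'b) monoid_scheme \<Rightarrow> ('a \<times> 'a) set \<Rightarrow> bool" where
  "monoid_congruence M \<rho> \<longleftrightarrow> equiv (carrier M) \<rho> \<and>
     (\<forall>a b c d. (a, b) \<in> \<rho> \<longrightarrow> (c, d) \<in> \<rho> \<longrightarrow> (a \<otimes>\<^bsub>M\<^esub> c, b \<otimes>\<^bsub>M\<^esub> d) \<in> \<rho>)"

definition generated_congruence ::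
    "('a, 'b) monoid_scheme \<Rightarrow> ('a \<times> 'a) set \<Rightarrow> ('a \<times> 'a) set" where
  "generated_congruence M Q = \<Inter> {\<rho>. monoid_congruence M \<rho> \<and> Q \<subseteq> \<rho>}"

text \<open>For a congruence the union in the product is the single class of \<open>x \<otimes> y\<close>, whatever
  representatives are taken.\<close>

definition quotient_monoid ::
    "('a, 'b) monoid_scheme \<Rightarrow> ('a \<times> 'a) set \<Rightarrow> 'a set monoid" where
  "quotient_monoid M \<rho> =
     \<lparr>carrier = carrier M // \<rho>,
      mult = (\<lambda>X Y. \<Union>x\<in>X. \<Union>y\<in>Y. \<rho> `` {x \<otimes>\<^bsub>M\<^esub> y}),
      one = \<rho> `` {\<one>\<^bsub>M\<^esub>}\<rparr>"

text \<open>The library's \<open>\<cong>\<close> asks for a multiplicative bijection; between monoids such a map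
  automatically preserves the identity. The condition that \<open>Q\<close> relates words over \<open>A\<close> matters:
  otherwise no congruence contains \<open>Q\<close> and the intersection above degenerates.\<close>

definition defined_by_presentation ::
    "('c, 'd) monoid_scheme \<Rightarrow> 'a set \<Rightarrow> ('a list \<times> 'a list) set \<Rightarrow> bool" where
  "defined_by_presentation M A Q \<longleftrightarrow>
     Q \<subseteq> lists A \<times> lists A \<and>
     M \<cong> quotient_monoid (free_monoid A) (generated_congruence (free_monoid A) Q)"


section \<open>The monoids of partial permutations\<close>

text \<open>Partial maps act on the right: the product of \<open>\<alpha>\<close> and \<open>\<beta>\<close> is first \<open>\<alpha>\<close>, then \<open>\<beta>\<close>.\<close>

definition sym_inv_monoid :: "nat \<Rightarrow> (nat \<rightharpoonup> nat) monoid" where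
  "sym_inv_monoid n =
     \<lparr>carrier = {\<alpha>. dom \<alpha> \<subseteq> {1..n} \<and> ran \<alpha> \<subseteq> {1..n} \<and> inj_on \<alpha> (dom \<alpha>)},
      mult = (\<lambda>\<alpha> \<beta>. \<beta> \<circ>\<^sub>m \<alpha>),
      one = Some |` {1..n}\<rparr>"

definition rot_perm :: "nat \<Rightarrow> nat \<Rightarrow> nat" where
  "rot_perm n i = (if i \<in> {1..n} then (if i = n then 1 else i + 1) else i)"

definition refl_perm :: "nat \<Rightarrow> nat \<Rightarrow> nat" where
  "refl_perm n i = (if i \<in> {1..n} then n + 1 - i else i)"

text \<open>The library's symmetric group composes from right to left, but the underlying set of a
  generated subgroup does not depend on that convention.\<close>

definition dihedral_perms :: "nat \<Rightarrow> (nat \<Rightarrow> nat) set" where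
  "dihedral_perms n = generate (sym_group n) {rot_perm n, refl_perm n}"

definition dihedral_inv_monoid :: "nat \<Rightarrow> (nat \<rightharpoonup> nat) monoid" where
  "dihedral_inv_monoid n =
     (sym_inv_monoid n)
       \<lparr>carrier := {(Some \<circ> \<sigma>) |` A | \<sigma> A. \<sigma> \<in> dihedral_perms n \<and> A \<subseteq> {1..n}}\<rparr>"

text \<open>List positions start at 0; the index modulo the length closes up the sequence.\<close>

definition cyclic_seq :: "nat list \<Rightarrow> bool" where
  "cyclic_seq as \<longleftrightarrow>
     card {i. i < length as \<and> as ! i > as ! (Suc i mod length as)} \<le> 1"

definition orientation_preserving :: "(nat \<rightharpoonup> nat) \<Rightarrow> bool" where
  "orientation_preserving \<alpha> \<longleftrightarrow>
     cyclic_seq (map (\<lambda>a. the (\<alpha> a)) (sorted_list_of_set (dom \<alpha>)))"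

definition OPDI :: "nat \<Rightarrow> (nat \<rightharpoonup> nat) monoid" where
  "OPDI n =
     (dihedral_inv_monoid n)
       \<lparr>carrier := {\<alpha> \<in> carrier (dihedral_inv_monoid n). orientation_preserving \<alpha>}\<rparr>"


section \<open>The alphabet and the relations\<close>

datatype letter = Gen_g | Gen_e1 | Gen_x nat

definition alphabet :: "nat \<Rightarrow> letter set" where
  "alphabet m = {Gen_g, Gen_e1} \<union> Gen_x ` {1..m}"

definition word_pow :: "'a list \<Rightarrow> nat \<Rightarrow> 'a list" (infixr \<open>\<up>\<close> 80) where
  "w \<up> k = concat (replicate k w)"

abbreviation gw :: "letter list" where "gw \<equiv> [Gen_g]"
abbreviation ew :: "letter list" where "ew \<equiv> [Gen_e1]"
abbreviation xw :: "nat \<Rightarrow> letter list" where "xw i \<equiv> [Gen_x i]"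

text \<open>A list rather than a set, so that coinciding relations with different parameters are counted
  separately; a chain \<open>u = v = w\<close> contributes the pairs \<open>(u, v)\<close> and \<open>(v, w)\<close>. In the parameter
  ranges used, with \<open>m = (n - 1) div 2\<close> and \<open>n \<ge> 4\<close>, no subtraction in an exponent is truncated.\<close>

definition relations :: "nat \<Rightarrow> nat \<Rightarrow> (letter list \<times> letter list) list" where
  "relations n m =
     [(gw \<up> n, [])] @
     [(ew \<up> 2, ew)] @
     [(ew @ gw \<up> (n - j + i) @ ew @ gw \<up> (n - i + j),
       gw \<up> (n - j + i) @ ew @ gw \<up> (n - i + j) @ ew).
        i \<leftarrow> [1..<n + 1], j \<leftarrow> [1..<n + 1], i < j] @
     [(gw @ (ew @ gw \<up> (n - 1)) \<up> n, (ew @ gw \<up> (n - 1)) \<up> n)] @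
     concat [[(ew @ xw i, xw i @ ew),
              (xw i @ ew,
               gw \<up> (n - 2 * i) @ (ew @ gw \<up> (n - 1)) \<up> (n - i - 1) @ ew @ gw \<up> (n - 2) @
                 (ew @ gw \<up> (n - 1)) \<up> (i - 1))].
        i \<leftarrow> [1..<m + 1]] @
     [(xw i @ gw \<up> (n - j + 1) @ ew @ gw \<up> (j - 1), xw i).
        i \<leftarrow> [1..<m + 1], j \<leftarrow> [2..<n + 1], j \<noteq> n - i + 1] @
     [(gw \<up> (n - j + 1) @ ew @ gw \<up> (j - 1) @ xw i, xw i).
        i \<leftarrow> [1..<m + 1], j \<leftarrow> [2..<n + 1], j \<noteq> i + 1] @
     concat [[(xw i @ gw \<up> i @ ew @ gw \<up> (n - i), gw \<up> (n - i) @ ew @ gw \<up> i @ xw i),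
              (gw \<up> (n - i) @ ew @ gw \<up> i @ xw i,
               gw \<up> (n - 1) @ (ew @ gw \<up> (n - 1)) \<up> (n - 1))].
        i \<leftarrow> [1..<m + 1]] @
     [((xw 1 @ gw) \<up> 2, gw \<up> (n - 2) @ (ew @ gw \<up> (n - 1)) \<up> (n - 2))] @
     [((xw i @ gw \<up> i) \<up> 2,
       gw \<up> (n - 1) @ (ew @ gw \<up> (n - 1)) \<up> (i - 2) @ ew @ gw \<up> (n - 2) @
         (ew @ gw \<up> (n - 1)) \<up> (n - i - 1)).
        i \<leftarrow> [2..<m + 1]]"

end

theory Submission
  imports Defs
begin

text \<open>
  Write \<open>G k = g\<^sup>k\<close> with \<open>k\<close> an integer read modulo \<open>n\<close>, and \<open>E k = g\<^sup>-\<^sup>k e\<^sub>1 g\<^sup>k\<close>. Given \<open>g\<^sup>n = 1\<close>, the relations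
  say that the \<open>E k\<close> are commuting idempotents whose full product absorbs \<open>g\<close>, and that
  multiplying \<open>x\<^sub>i\<close> by an \<open>E k\<close> either leaves it unchanged or turns it into a product of letters
  \<open>g\<close> and \<open>e\<^sub>1\<close>. Hence every word equals a normal form \<open>E k\<^sub>1 \<cdots> E k\<^sub>r G k\<close> (a restricted rotation) or
  \<open>G a x\<^sub>i G b\<close> (a reflection of rank two that is not a restricted rotation, since \<open>2 i < n\<close>).
  Two normal forms inducing the same partial permutation are equal in every monoid satisfying the
  relations. Finally a restriction of a reflection to at least three points has at least two
  descents, so the partial permutations of normal forms are exactly the elements of \<open>OPDI n\<close>.
\<close>

section \<open>Conjugates of the idempotent generator\<close>

text \<open>The normal form argument takes place in a type of class \<open>monoid_mult\<close>,
  whereas the presented monoid is a set of classes of words. It is therefore represented faithfully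
  by right multiplication on its own classes, and \<open>endo\<close> supplies the type. The action
  on points lives in the same type constructor, so one locale serves both: the action on points
  tells normal forms apart, the regular representation shows that every word equals one of them.
  With residues counted from 0, x_i is the reflection a -> -a restricted to the residues 0 and i. A
  pair of points at distance d is also a pair at distance n - d, and for d = 0 or 2 d = n every
  reflection agrees with a rotation on the pair. The distances that remain are 1, ..., m, which is
  the origin of m. The delicate product is x_i g^b x_j. It has rank two only for i = j and b = i
  modulo n, where a relation evaluates it; in every other case an idempotent slipped between the
  factors lowers the rank.\<close>

typedef 'a endo = "UNIV :: ('a \<Rightarrow> 'a) set"
  morphisms apply_endo Endo ..

declare upt_Suc [simp del] One_nat_def [simp del]

setup_lifting type_definition_endo

instantiation endo :: (type) monoid_mult
begin

lift_definition one_endo :: "'a endo" is id .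

text \<open>Words are read from left to right, so the left factor is applied first.\<close>

lift_definition times_endo :: "'a endo \<Rightarrow> 'a endo \<Rightarrow> 'a endo" is "\<lambda>f h. h \<circ> f" .

instance
  by standard (transfer, simp add: comp_assoc)+

end

lemma apply_endo_one [simp]: "apply_endo 1 p = p"
  by transfer simp

lemma apply_endo_times [simp]: "apply_endo (a * b) p = apply_endo b (apply_endo a p)"
  by transfer simp

lemma endo_eqI: "(\<And>p. apply_endo a p = apply_endo b p) \<Longrightarrow> a = b"
  by transfer auto

definition word_val :: "('b \<Rightarrow> 'a::monoid_mult) \<Rightarrow> 'b list \<Rightarrow> 'a" where
  "word_val f w = prod_list (map f w)"

lemma word_val_simps [simp]:
  "word_val f [] = 1"
  "word_val f (l # w) = f l * word_val f w"
  "word_val f (u @ v) = word_val f u * word_val f v"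
  by (simp_all add: word_val_def)

lemma word_val_pow [simp]: "word_val f (w \<up> k) = word_val f w ^ k"
  by (induction k) (simp_all add: word_pow_def)

definition satisfies_relations :: "nat \<Rightarrow> nat \<Rightarrow> (letter \<Rightarrow> 'a::monoid_mult) \<Rightarrow> bool" where
  "satisfies_relations n m f \<longleftrightarrow> (\<forall>(u, v) \<in> set (relations n m). word_val f u = word_val f v)"

text \<open>Only g^n = 1 is assumed, which is what makes \<open>G\<close> a homomorphism on the
  integers modulo n. The other relations stay outside, so that inside the locale they can be
  rewritten by equivalences and then be either used (presented monoid) or verified (action on
  points).\<close>

locale rotation_model =
  fixes n :: nat and f :: "letter \<Rightarrow> 'a::monoid_mult"
  assumes n_pos: "0 < n" and rotation_order: "f Gen_g ^ n = 1"
begin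

definition G :: "int \<Rightarrow> 'a" where
  "G k = f Gen_g ^ nat (k mod int n)"

definition E :: "int \<Rightarrow> 'a" where
  "E k = G (- k) * f Gen_e1 * G k"

definition P :: "int list \<Rightarrow> 'a" where
  "P xs = prod_list (map E xs)"

text \<open>In the action on points, \<open>E k\<close> is the identity except that it is undefined
  at residue \<open>k\<close>. Hence \<open>K C\<close> is the partial identity on the residues in
  \<open>C\<close>, and \<open>K {}\<close> is the empty map.\<close>

definition complement_list :: "nat set \<Rightarrow> int list" where
  "complement_list C = map int (filter (\<lambda>k. k \<notin> C) [0..<n])"

abbreviation K :: "nat set \<Rightarrow> 'a" where
  "K C \<equiv> P (complement_list C)"

abbreviation x :: "nat \<Rightarrow> 'a" where
  "x i \<equiv> f (Gen_x i)"

lemma P_simps [simp]: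
  "P [] = 1" "P (a # xs) = E a * P xs" "P (xs @ ys) = P xs * P ys"
  by (simp_all add: P_def)

lemma pow_eq_G: "f Gen_g ^ k = G (int k)"
proof -
  have "f Gen_g ^ k = f Gen_g ^ (k mod n + n * (k div n))" by simp
  also have "\<dots> = f Gen_g ^ (k mod n)"
    unfolding power_add power_mult by (simp add: rotation_order)
  finally show ?thesis
    by (simp add: G_def nat_mod_as_int)
qed

lemma G_cong: "int n dvd a - b \<Longrightarrow> G a = G b"
  by (simp add: G_def flip: mod_eq_dvd_iff)

lemma G_0 [simp]: "G 0 = 1"
  by (simp add: G_def)

lemma G_mult: "G a * G b = G (a + b)"
proof -
  have "G a * G b = G (int (nat (a mod int n) + nat (b mod int n)))"
    unfolding pow_eq_G [symmetric] by (simp add: G_def power_add)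
  also have "\<dots> = G (a + b)"
    using n_pos by (intro G_cong) (simp add: mod_eq_dvd_iff [symmetric] mod_add_eq)
  finally show ?thesis .
qed

lemma G_mult_left: "G a * (G b * c) = G (a + b) * c"
  by (simp add: G_mult flip: mult.assoc)

lemma E_cong: "int n dvd a - b \<Longrightarrow> E a = E b"
  using G_cong [of a b] G_cong [of "- a" "- b"] unfolding E_def
  by (metis dvd_minus_iff minus_diff_eq uminus_add_conv_diff diff_minus_eq_add)

lemma e_eq_E: "f Gen_e1 = E 0"
  by (simp add: E_def)

text \<open>Rotations permute the idempotents by conjugation, as in a semidirect product. This rule
  lets all rotations be collected on either side of a product of idempotents.\<close>

lemma E_G: "E a * G k = G k * E (a + k)"
  by (simp add: E_def mult.assoc G_mult G_mult_left)

lemma E_G_left: "E a * (G k * c) = G k * (E (a + k) * c)"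
  using E_G [of a k] by (metis mult.assoc)

lemma G_E: "G k * E a = E (a - k) * G k"
  by (simp add: E_G)

lemma P_G: "P xs * G k = G k * P (map (\<lambda>a. a + k) xs)"
  by (induction xs) (simp_all add: E_G_left mult.assoc)

lemma G_P: "G k * P xs = P (map (\<lambda>a. a - k) xs) * G k"
  by (simp add: P_G o_def)

lemma map_int_shift: "map (\<lambda>k. int k + int c) [a..<b] = map int [a + c..<b + c]"
  by (induction b) (auto simp: upt_Suc)

lemma G_P_upt: "G (- int c) * P (map int [a..<b]) = P (map int [a + c..<b + c]) * G (- int c)"
  using map_int_shift [of c a b] by (simp add: G_P o_def)

lemma G_P_upt_left:
  "G (- int c) * (P (map int [a..<b]) * d) = P (map int [a + c..<b + c]) * (G (- int c) * d)"
  by (simp add: G_P_upt flip: mult.assoc)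

text \<open>Since g^(n-1) is the inverse of g, collecting the rotations on the right turns
  successive letters e_1 into \<open>E 0\<close>, \<open>E 1\<close>, and so on.\<close>

lemma eg_pow: "(f Gen_e1 * f Gen_g ^ (n - 1)) ^ k = P (map int [0..<k]) * G (- int k)"
proof (induction k)
  case (Suc k)
  have g1: "f Gen_g ^ (n - 1) = G (- 1)"
    unfolding pow_eq_G using n_pos by (intro G_cong) (simp add: of_nat_diff)
  have "G (- int k) * (E 0 * G (- 1)) = E (int k) * G (- int (Suc k))"
    by (simp add: G_E G_mult mult.assoc algebra_simps flip: mult.assoc [of _ "E 0"])
  then show ?case
    unfolding power_Suc2 Suc.IH unfolding e_eq_E g1 by (simp add: mult.assoc upt_Suc)
qed simp

lemma conjugate_eq_E:
  assumes "1 \<le> j" "j \<le> n"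
  shows "f Gen_g ^ (n - j + 1) * (f Gen_e1 * f Gen_g ^ (j - 1)) = E (int (j - 1))"
  unfolding E_def pow_eq_G mult.assoc
  by (rule arg_cong2 [where f = "(*)"], rule G_cong) (use assms in \<open>simp_all add: of_nat_diff\<close>)

text \<open>A single g^(n-2) in place of g^(n-1) shifts by two instead of one, so exactly the index
  \<open>p + 1\<close> is left out. This is how the right-hand sides of the relations encode a
  residue that survives.\<close>

lemma eg_pow_skip:
  "(f Gen_e1 * f Gen_g ^ (n - 1)) ^ p * (f Gen_e1 * (f Gen_g ^ (n - 2) *
      (f Gen_e1 * f Gen_g ^ (n - 1)) ^ q))
    = P (map int [0..<p + 1]) * P (map int [p + 2..<p + q + 2]) * G (- int (p + q + 2))"
  if "n \<ge> 2"
proof -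
  have g2: "f Gen_g ^ (n - 2) = G (- 2)"
    unfolding pow_eq_G using that by (intro G_cong) (simp add: of_nat_diff)
  have e: "- int p - 2 = - int (p + 2)" "p + q + 2 = q + (p + 2)"
    by simp_all
  have tail: "G (- int p - 2) * (P (map int [0..<q]) * G (- int q)) =
      P (map int [p + 2..<p + q + 2]) * G (- int (p + q + 2))"
    unfolding e G_P_upt_left by (simp add: G_mult algebra_simps)
  have "G (- int p) * (E 0 * (G (- 2) * c)) = E (int p) * (G (- int p - 2) * c)" for c
    by (simp add: G_E G_mult_left mult.assoc flip: mult.assoc [of _ "E 0"])
  moreover have "P (map int [0..<p + 1]) = P (map int [0..<p]) * E (int p)"
    by (simp add: upt_Suc flip: Suc_eq_plus1)
  ultimately show ?thesis
    unfolding eg_pow unfolding g2 e_eq_E mult.assoc using tail by (simp add: mult.assoc)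
qed

end

text \<open>The predicate \<open>R\<close> is left arbitrary because the list is inspected for two
  purposes: equality of values in a monoid, and membership of both words in the free monoid.\<close>

lemma ball_relations_iff:
  "(\<forall>(u, v) \<in> set (relations n m). R u v) \<longleftrightarrow>
    R (gw \<up> n) [] \<and> R (ew \<up> 2) ew \<and>
    (\<forall>i j. 1 \<le> i \<longrightarrow> i < j \<longrightarrow> j \<le> n \<longrightarrow>
      R (ew @ gw \<up> (n - j + i) @ ew @ gw \<up> (n - i + j))
        (gw \<up> (n - j + i) @ ew @ gw \<up> (n - i + j) @ ew)) \<and>
    R (gw @ (ew @ gw \<up> (n - 1)) \<up> n) ((ew @ gw \<up> (n - 1)) \<up> n) \<and>
    (\<forall>i\<in>{1..m}. R (ew @ xw i) (xw i @ ew) \<and>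
      R (xw i @ ew) (gw \<up> (n - 2 * i) @ (ew @ gw \<up> (n - 1)) \<up> (n - i - 1) @ ew @
        gw \<up> (n - 2) @ (ew @ gw \<up> (n - 1)) \<up> (i - 1))) \<and>
    (\<forall>i\<in>{1..m}. \<forall>j\<in>{2..n}. j \<noteq> n - i + 1 \<longrightarrow>
      R (xw i @ gw \<up> (n - j + 1) @ ew @ gw \<up> (j - 1)) (xw i)) \<and>
    (\<forall>i\<in>{1..m}. \<forall>j\<in>{2..n}. j \<noteq> i + 1 \<longrightarrow>
      R (gw \<up> (n - j + 1) @ ew @ gw \<up> (j - 1) @ xw i) (xw i)) \<and>
    (\<forall>i\<in>{1..m}.
      R (xw i @ gw \<up> i @ ew @ gw \<up> (n - i)) (gw \<up> (n - i) @ ew @ gw \<up> i @ xw i) \<and>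
      R (gw \<up> (n - i) @ ew @ gw \<up> i @ xw i) (gw \<up> (n - 1) @ (ew @ gw \<up> (n - 1)) \<up> (n - 1))) \<and>
    R ((xw 1 @ gw) \<up> 2) (gw \<up> (n - 2) @ (ew @ gw \<up> (n - 1)) \<up> (n - 2)) \<and>
    (\<forall>i\<in>{2..m}. R ((xw i @ gw \<up> i) \<up> 2)
      (gw \<up> (n - 1) @ (ew @ gw \<up> (n - 1)) \<up> (i - 2) @ ew @ gw \<up> (n - 2) @
        (ew @ gw \<up> (n - 1)) \<up> (n - i - 1)))"
proof -
  have *: "{a..<b + 1} = {a..b}" for a b :: nat by auto
  show ?thesis
    unfolding relations_def set_append ball_Un
    by (intro arg_cong2 [where f = "(\<and>)"]) (force simp: *)+
qed

lemma upt_split: "a \<le> c \<Longrightarrow> c \<le> b \<Longrightarrow> [a..<b] = [a..<c] @ [c..<b]"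
  using upt_add_eq_append [of a c "b - c"] by simp

section \<open>The relations as identities between rotations, idempotents and reflections\<close>

context rotation_model
begin

lemma complement_list_single:
  assumes "c < n"
  shows "complement_list {c} = map int ([0..<c] @ [Suc c..<n])"
proof -
  have "[0..<n] = [0..<c] @ c # [Suc c..<n]"
    using assms upt_split [of 0 c n] by (simp add: upt_conv_Cons)
  then show ?thesis
    by (simp add: complement_list_def)
qed

lemma complement_list_pair:
  assumes "0 < c" "c < n"
  shows "complement_list {0, c} = map int ([1..<c] @ [Suc c..<n])"
proof -
  have "[0..<n] = 0 # [1..<c] @ c # [Suc c..<n]"
    using assms upt_split [of 1 c n] by (simp add: upt_conv_Cons One_nat_def)
  then show ?thesis
    by (simp add: complement_list_def)
qed

lemma complement_list_empty: "complement_list {} = map int [0..<n]"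
  by (simp add: complement_list_def)

lemma relation_3_left:
  assumes "1 \<le> i" "i < j" "j \<le> n"
  shows "f Gen_e1 * (f Gen_g ^ (n - j + i) * (f Gen_e1 * f Gen_g ^ (n - i + j)))
    = E 0 * E (int j - int i)"
proof -
  have "f Gen_g ^ (n - j + i) = G (- (int j - int i))" "f Gen_g ^ (n - i + j) = G (int j - int i)"
    unfolding pow_eq_G using assms by (auto intro!: G_cong simp: of_nat_diff)
  then show ?thesis by (simp add: E_def mult.assoc)
qed

lemma relation_3_right:
  assumes "1 \<le> i" "i < j" "j \<le> n"
  shows "f Gen_g ^ (n - j + i) * (f Gen_e1 * (f Gen_g ^ (n - i + j) * f Gen_e1))
    = E (int j - int i) * E 0"
proof -
  have "f Gen_g ^ (n - j + i) = G (- (int j - int i))" "f Gen_g ^ (n - i + j) = G (int j - int i)"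
    unfolding pow_eq_G using assms by (auto intro!: G_cong simp: of_nat_diff)
  then show ?thesis by (simp add: E_def mult.assoc)
qed

lemma relation_5_right: "(f Gen_e1 * f Gen_g ^ (n - 1)) ^ n = K {}"
  unfolding eg_pow using G_cong [of "- int n" 0] by (simp add: complement_list_empty)

text \<open>With \<open>p = n - i - 1\<close> and \<open>q = i - 1\<close> the skipped index is
  \<open>n - i\<close>, and the trailing rotation is by -n, hence trivial. The result is x_i
  restricted to the residue i, written as a rotation by -2 i followed by a partial identity.\<close>

lemma relation_6_right:
  assumes "1 \<le> i" "2 * i < n"
  shows "f Gen_g ^ (n - 2 * i) * ((f Gen_e1 * f Gen_g ^ (n - 1)) ^ (n - i - 1) *
      (f Gen_e1 * (f Gen_g ^ (n - 2) * (f Gen_e1 * f Gen_g ^ (n - 1)) ^ (i - 1))))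
    = G (- 2 * int i) * K {n - i}"
proof -
  have g: "f Gen_g ^ (n - 2 * i) = G (- 2 * int i)"
    unfolding pow_eq_G using assms by (auto intro!: G_cong simp: of_nat_diff)
  have eqs: "n - i - 1 + 1 = n - i" "n - i - 1 + 2 = Suc (n - i)" "n - i - 1 + (i - 1) + 2 = n"
    using assms by simp_all
  have "G (- int n) = 1" using G_cong [of "- int n" 0] by simp
  moreover have "2 \<le> n" using assms by simp
  ultimately show ?thesis
    using assms by (simp only: eg_pow_skip g eqs) (simp add: complement_list_single)
qed

lemma relation_9_right:
  "f Gen_g ^ (n - 1) * (f Gen_e1 * f Gen_g ^ (n - 1)) ^ (n - 1) = K {0}"
proof -
  have g: "f Gen_g ^ (n - 1) = G (- int 1)" "G (- int (n - 1)) = G 1"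
    unfolding pow_eq_G using n_pos by (auto intro!: G_cong simp: of_nat_diff)
  show ?thesis
    unfolding eg_pow unfolding g G_P_upt_left using n_pos
    by (simp add: complement_list_single G_mult One_nat_def)
qed

text \<open>For i = 1 the surviving residues 0 and 1 are adjacent, so the remaining indices form one
  block starting at 2. For larger i there are two blocks, which is why the case i = 1 has a relation
  of its own shape.\<close>

lemma relation_10_right_first:
  assumes "2 \<le> n"
  shows "f Gen_g ^ (n - 2) * (f Gen_e1 * f Gen_g ^ (n - 1)) ^ (n - 2) = K {0, 1}"
proof -
  have g: "f Gen_g ^ (n - 2) = G (- int 2)" "G (- int (n - 2)) = G 2"
    unfolding pow_eq_G using assms by (auto intro!: G_cong simp: of_nat_diff)
  show ?thesis
    unfolding eg_pow unfolding g G_P_upt_left using assms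
    by (simp add: complement_list_pair G_mult flip: Suc_1)
qed

lemma relation_10_right:
  assumes "2 \<le> i" "2 * i < n"
  shows "f Gen_g ^ (n - 1) * ((f Gen_e1 * f Gen_g ^ (n - 1)) ^ (i - 2) *
      (f Gen_e1 * (f Gen_g ^ (n - 2) * (f Gen_e1 * f Gen_g ^ (n - 1)) ^ (n - i - 1))))
    = K {0, i}"
proof -
  have g: "f Gen_g ^ (n - 1) = G (- int 1)" "G (- int (n - 1)) = G 1"
    unfolding pow_eq_G using assms by (auto intro!: G_cong simp: of_nat_diff)
  have eqs: "i - 2 + 1 = i - 1" "i - 2 + 2 = i" "i - 2 + (n - i - 1) + 2 = n - 1"
    using assms by simp_all
  have "2 \<le> n" using assms by simp
  show ?thesis
    unfolding eg_pow_skip [OF \<open>2 \<le> n\<close>] mult.assoc unfolding g(1) eqs unfolding g(2) G_P_upt_left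
    using assms by (simp add: complement_list_pair G_mult Suc_eq_plus1)
qed

text \<open>The relations by residues. As x_i has domain {0, i} and image {0, -i}, an
  \<open>E k\<close> to its right is absorbed when \<open>k\<close> misses the image, and one to its
  left when \<open>k\<close> misses the domain. The other identities evaluate the products that lose
  a point, and the square of \<open>x i * G (int i)\<close>.\<close>

definition conjugate_relations :: "nat \<Rightarrow> bool" where
  "conjugate_relations m \<longleftrightarrow>
     E 0 * E 0 = E 0 \<and> (\<forall>a b. E a * E b = E b * E a) \<and> G 1 * K {} = K {} \<and>
     (\<forall>i\<in>{1..m}.
        E 0 * x i = x i * E 0 \<and>
        x i * E 0 = G (- 2 * int i) * K {n - i} \<and>
        (\<forall>k. \<not> int n dvd k \<longrightarrow> \<not> int n dvd k + int i \<longrightarrow> x i * E k = x i) \<and>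
        (\<forall>k. \<not> int n dvd k \<longrightarrow> \<not> int n dvd k - int i \<longrightarrow> E k * x i = x i) \<and>
        x i * E (- int i) = E (int i) * x i \<and>
        E (int i) * x i = K {0} \<and>
        x i * G (int i) * (x i * G (int i)) = K {0, i})"

lemma satisfies_relations_unfold:
  assumes "n \<ge> 4" "m = (n - 1) div 2"
  shows "satisfies_relations n m f \<longleftrightarrow>
    E 0 * E 0 = E 0 \<and>
    (\<forall>i j. 1 \<le> i \<longrightarrow> i < j \<longrightarrow> j \<le> n \<longrightarrow> E 0 * E (int j - int i) = E (int j - int i) * E 0) \<and>
    G 1 * K {} = K {} \<and>
    (\<forall>i\<in>{1..m}. E 0 * x i = x i * E 0 \<and> x i * E 0 = G (- 2 * int i) * K {n - i}) \<and>
    (\<forall>i\<in>{1..m}. \<forall>j\<in>{2..n}. j \<noteq> n - i + 1 \<longrightarrow> x i * E (int (j - 1)) = x i) \<and>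
    (\<forall>i\<in>{1..m}. \<forall>j\<in>{2..n}. j \<noteq> i + 1 \<longrightarrow> E (int (j - 1)) * x i = x i) \<and>
    (\<forall>i\<in>{1..m}. x i * E (- int i) = E (int i) * x i \<and> E (int i) * x i = K {0}) \<and>
    x 1 * G (int 1) * (x 1 * G (int 1)) = K {0, 1} \<and>
    (\<forall>i\<in>{2..m}. x i * G (int i) * (x i * G (int i)) = K {0, i})"
proof -
  have m: "2 * i < n" if "i \<in> {1..m}" for i
    using that assms by auto
  have E_pos: "f Gen_g ^ (n - i) * (f Gen_e1 * (f Gen_g ^ i * c)) = E (int i) * c"
    if "i \<in> {1..m}" for i c
    using conjugate_eq_E [of "i + 1"] m [OF that] by (simp add: mult.assoc [symmetric])
  have E_neg: "f Gen_g ^ i * (f Gen_e1 * f Gen_g ^ (n - i)) = E (- int i)" if "i \<in> {1..m}" for i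
    unfolding E_def pow_eq_G mult.assoc
    using m [OF that] by (intro arg_cong2 [where f = "(*)"] refl G_cong) (auto simp: of_nat_diff)
  have E_left: "f Gen_g ^ (n - j + 1) * (f Gen_e1 * (f Gen_g ^ (j - 1) * c)) = E (int (j - 1)) * c"
    if "j \<in> {2..n}" for j c
    using conjugate_eq_E [of j] that by (simp add: mult.assoc [symmetric])
  show ?thesis
    unfolding satisfies_relations_def ball_relations_iff word_val_simps word_val_pow mult_1_right
      mult.assoc
    \<comment> \<open>The conjunct for g^n = 1 becomes true and disappears; the nine others are then
      matched in order.\<close>
    apply (simp only: rotation_order simp_thms)
    apply (intro arg_cong2 [where f = "(\<and>)"])
    subgoal by (simp add: e_eq_E power2_eq_square)
    subgoal by (intro iff_allI imp_cong refl) (simp only: relation_3_left relation_3_right)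
    subgoal unfolding relation_5_right using pow_eq_G [of 1] by simp
    subgoal by (rule ball_cong [OF refl]) (simp only: m relation_6_right atLeastAtMost_iff, simp add: e_eq_E)
    subgoal using conjugate_eq_E by (intro ball_cong [OF refl]) simp
    subgoal using E_left by (intro ball_cong [OF refl]) simp
    subgoal using E_left by (intro ball_cong [OF refl]) (simp only: E_pos E_neg relation_9_right)
    subgoal using relation_10_right_first pow_eq_G [of 1] assms by (simp add: power2_eq_square mult.assoc)
    subgoal by (rule ball_cong [OF refl], subst relation_10_right)
       (use m in \<open>auto simp: pow_eq_G power2_eq_square mult.assoc\<close>)
    done
qed

lemma dvd_imp_zero: "int n dvd k \<Longrightarrow> \<bar>k\<bar> < int n \<Longrightarrow> k = 0"
  using dvd_imp_le_int [of k "int n"] by auto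

lemma E_conj: "G (- a) * E k * G a = E (k + a)"
  by (simp add: E_def mult.assoc G_mult G_mult_left algebra_simps)

text \<open>Conjugation by \<open>G a\<close> moves a commuting pair \<open>E 0\<close>,
  \<open>E d\<close> to \<open>E a\<close>, \<open>E (a + d)\<close>, and every pair of residues has
  this form.\<close>

lemma E_commute_all:
  assumes "\<And>d. 0 < d \<Longrightarrow> d < int n \<Longrightarrow> E 0 * E d = E d * E 0"
  shows "E a * E b = E b * E a"
proof -
  define d where "d = (b - a) mod int n"
  have d: "0 \<le> d" "d < int n" using n_pos by (simp_all add: d_def)
  then have "E 0 * E d = E d * E 0" using assms [of d] by (cases "d = 0") auto
  then have "G (- a) * (E 0 * E d) * G a = G (- a) * (E d * E 0) * G a" by simp
  moreover have "G (- a) * (E k * E l) * G a = E (k + a) * E (l + a)" for k l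
    by (simp add: E_conj [symmetric] mult.assoc G_mult_left)
  moreover have "E (d + a) = E b"
    by (rule E_cong) (simp add: d_def mod_eq_dvd_iff [symmetric] mod_simps)
  ultimately show ?thesis by simp
qed

text \<open>Both directions matter: from left to right the relations become usable in the presented
  monoid, from right to left it suffices to verify the residue form for the action on
  points.\<close>

lemma satisfies_relations_iff:
  assumes "n \<ge> 4" "m = (n - 1) div 2"
  shows "satisfies_relations n m f \<longleftrightarrow> conjugate_relations m"
proof
  have m: "2 * i < n" if "i \<in> {1..m}" for i
    using that assms by auto
  have split_1: "(\<forall>i\<in>{1..m}. Q i) \<longleftrightarrow> Q 1 \<and> (\<forall>i\<in>{2..m}. Q i)" for Q :: "nat \<Rightarrow> bool"
  proof -
    have "{1..m} = insert 1 {2..m}" using assms by auto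
    then show ?thesis by simp
  qed
  note unfold = satisfies_relations_unfold [OF assms]
  show "conjugate_relations m" if "satisfies_relations n m f"
  proof -
    note r = unfold [THEN iffD1, OF that]
    \<comment> \<open>The parameter \<open>j\<close> of the relations stands for the residue
      \<open>j - 1\<close>; a nonzero residue therefore corresponds to some \<open>j\<close> from 2
      to \<open>n\<close>.\<close>
    have E_rep: "\<exists>j. int (j - 1) = k mod int n \<and> j \<in> {2..n}" if "\<not> int n dvd k" for k
    proof -
      have "k mod int n \<noteq> 0" "0 \<le> k mod int n" "k mod int n < int n"
        using that n_pos by (simp_all add: dvd_eq_mod_eq_0)
      then show ?thesis by (intro exI [of _ "nat (k mod int n) + 1"]) auto
    qed
    have "E 0 * E d = E d * E 0" if "0 < d" "d < int n" for d
    proof -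
      have "nat d + 1 \<le> n" "1 < nat d + 1" using that by auto
      then have "E 0 * E (int (nat d + 1) - int 1) = E (int (nat d + 1) - int 1) * E 0"
        using r by blast
      then show ?thesis using that by simp
    qed
    then have comm: "\<forall>a b. E a * E b = E b * E a" using E_commute_all by blast
    have right: "x i * E k = x i" if "i \<in> {1..m}" "\<not> int n dvd k" "\<not> int n dvd k + int i" for i k
    proof -
      from E_rep [OF that(2)] obtain j where j: "int (j - 1) = k mod int n" "j \<in> {2..n}" by blast
      have "E k = E (int (j - 1))" by (rule E_cong) (simp add: j mod_eq_dvd_iff [symmetric])
      moreover have "j \<noteq> n - i + 1"
      proof
        assume "j = n - i + 1"
        then have "k mod int n + int i = int n" using j m [OF that(1)] by (auto simp: of_nat_diff)
        then have "(k + int i) mod int n = 0" by (metis mod_add_left_eq mod_self)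
        then show False using that by auto
      qed
      ultimately show ?thesis using r j(2) that(1) by metis
    qed
    have left: "E k * x i = x i" if "i \<in> {1..m}" "\<not> int n dvd k" "\<not> int n dvd k - int i" for i k
    proof -
      from E_rep [OF that(2)] obtain j where j: "int (j - 1) = k mod int n" "j \<in> {2..n}" by blast
      have "E k = E (int (j - 1))" by (rule E_cong) (simp add: j mod_eq_dvd_iff [symmetric])
      moreover have "j \<noteq> i + 1"
      proof
        assume "j = i + 1"
        then have "k mod int n = int i" using j by simp
        then have "int n dvd k - int i" by (metis mod_eq_dvd_iff mod_mod_trivial)
        then show False using that by auto
      qed
      ultimately show ?thesis using r j(2) that(1) by metis
    qed
    have pair: "\<forall>i\<in>{1..m}. x i * G (int i) * (x i * G (int i)) = K {0, i}"
      unfolding split_1 using r by blast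
    show ?thesis
      unfolding conjugate_relations_def using r comm right left pair by simp
  qed
  show "satisfies_relations n m f" if "conjugate_relations m"
  proof -
    note r = that [unfolded conjugate_relations_def]
    have pair: "\<forall>i\<in>{1..m}. x i * G (int i) * (x i * G (int i)) = K {0, i}"
      using r by blast
    have nd: "\<not> int n dvd k" if "k \<noteq> 0" "\<bar>k\<bar> < int n" for k using dvd_imp_zero that by blast
    have right: "x i * E (int (j - 1)) = x i" if "i \<in> {1..m}" "j \<in> {2..n}" "j \<noteq> n - i + 1" for i j
    proof -
      have "\<not> int n dvd (int (j - 1) + int i - int n)"
        using that m [of i] by (intro nd) (auto simp: of_nat_diff)
      then have "\<not> int n dvd int (j - 1) + int i" by (simp add: dvd_diff_left_iff)
      moreover have "\<not> int n dvd int (j - 1)" using that by (intro nd) auto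
      ultimately show ?thesis using r that(1) by blast
    qed
    have left: "E (int (j - 1)) * x i = x i" if "i \<in> {1..m}" "j \<in> {2..n}" "j \<noteq> i + 1" for i j
    proof -
      have "\<not> int n dvd (int (j - 1) - int i)"
        using that m [of i] by (intro nd) (auto simp: of_nat_diff)
      moreover have "\<not> int n dvd int (j - 1)" using that by (intro nd) auto
      ultimately show ?thesis using r that(1) by blast
    qed
    show ?thesis
      unfolding unfold using r right left pair [unfolded split_1] by simp
  qed
qed

end

section \<open>Normal forms\<close>

context rotation_model
begin

lemma in_complement_list_iff:
  "(\<exists>b\<in>set (complement_list C). int n dvd a - b) \<longleftrightarrow> nat (a mod int n) \<notin> C"
proof
  assume "\<exists>b\<in>set (complement_list C). int n dvd a - b"
  then obtain k where "k < n" "k \<notin> C" "int n dvd a - int k"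
    by (auto simp: complement_list_def)
  moreover from this have "a mod int n = int k" by (simp flip: mod_eq_dvd_iff)
  ultimately show "nat (a mod int n) \<notin> C" by simp
next
  assume *: "nat (a mod int n) \<notin> C"
  show "\<exists>b\<in>set (complement_list C). int n dvd a - b"
  proof
    show "int n dvd a - a mod int n" by (simp flip: mod_eq_dvd_iff)
    show "a mod int n \<in> set (complement_list C)"
      using * n_pos unfolding complement_list_def
      by (auto intro!: image_eqI [of _ _ "nat (a mod int n)"] simp: nat_less_iff)
  qed
qed

end

definition rotation_word :: "nat \<Rightarrow> int \<Rightarrow> letter list" where
  "rotation_word n k = gw \<up> nat (k mod int n)"

definition idempotent_word :: "nat \<Rightarrow> int list \<Rightarrow> letter list" where
  "idempotent_word n xs = concat (map (\<lambda>a. rotation_word n (- a) @ ew @ rotation_word n a) xs)"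

text \<open>Normal forms are words rather than monoid elements, because the same word has to be
  evaluated in the action on points and in an abstract monoid.\<close>

definition normal_words :: "nat \<Rightarrow> nat \<Rightarrow> letter list set" where
  "normal_words n m =
     {idempotent_word n xs @ rotation_word n k | xs k. True} \<union>
     {rotation_word n a @ xw i @ rotation_word n b | a i b. i \<in> {1..m}}"

lemma normal_words_in_lists: "normal_words n m \<subseteq> lists (alphabet m)"
proof -
  have rot: "set (rotation_word n k) \<subseteq> {Gen_g}" for k
    by (auto simp: rotation_word_def word_pow_def)
  have idem: "set (idempotent_word n xs) \<subseteq> {Gen_g, Gen_e1}" for xs
    by (auto simp: idempotent_word_def dest: rot [THEN subsetD])
  show ?thesis
    unfolding normal_words_def alphabet_def
    by (auto dest: rot [THEN subsetD] idem [THEN subsetD])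
qed

context rotation_model
begin

lemma word_val_rotation_word [simp]: "word_val f (rotation_word n k) = G k"
  by (simp add: rotation_word_def G_def)

lemma word_val_idempotent_word [simp]: "word_val f (idempotent_word n xs) = P xs"
  by (induction xs) (simp_all add: idempotent_word_def E_def mult.assoc)

end

section \<open>Consequences of the relations: every word has a normal form\<close>

locale relation_model = rotation_model +
  fixes m :: nat
  assumes n_ge_4: "4 \<le> n" and m_eq: "m = (n - 1) div 2"
    and relations_hold: "satisfies_relations n m f"
begin

lemma conjugate_relations_hold: "conjugate_relations m"
  using relations_hold satisfies_relations_iff n_ge_4 m_eq by blast

lemmas conjugate_relationsD = conjugate_relations_hold [unfolded conjugate_relations_def]

lemma index_bound: "i \<in> {1..m} \<Longrightarrow> 1 \<le> i \<and> 2 * i < n"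
  using n_ge_4 by (auto simp: m_eq)

lemma E_commute: "E a * E b = E b * E a"
  using conjugate_relationsD by blast

lemma E_idem: "E a * E a = E a"
proof -
  have "E a = G (- a) * E 0 * G a" by (simp add: E_conj)
  moreover have "E 0 * E 0 = E 0" using conjugate_relationsD by blast
  then have "G (- a) * E 0 * G a * (G (- a) * E 0 * G a) = G (- a) * E 0 * G a"
    by (simp add: mult.assoc G_mult_left flip: mult.assoc [of "E 0" "E 0"])
  ultimately show ?thesis by metis
qed

lemma E_P_commute: "E a * P xs = P xs * E a"
proof (induction xs)
  case (Cons b xs)
  have "E a * P (b # xs) = E a * E b * P xs" by (simp add: mult.assoc)
  also have "\<dots> = E b * (E a * P xs)" by (simp only: E_commute [of a b] mult.assoc)
  also have "\<dots> = P (b # xs) * E a" by (simp add: Cons mult.assoc)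
  finally show ?case .
qed simp

lemma P_commute: "P xs * P ys = P ys * P xs"
proof (induction xs)
  case (Cons b xs)
  have "P (b # xs) * P ys = E b * P ys * P xs" by (simp add: Cons mult.assoc)
  also have "\<dots> = P ys * P (b # xs)" by (simp only: E_P_commute mult.assoc P_simps)
  finally show ?case .
qed simp

lemma E_P_absorb: "b \<in> set ys \<Longrightarrow> int n dvd a - b \<Longrightarrow> E a * P ys = P ys"
proof (induction ys)
  case (Cons c ys)
  show ?case
  proof (cases "c = b")
    case True
    with Cons have "E a = E c" using E_cong by blast
    then show ?thesis by (simp add: E_idem flip: mult.assoc)
  next
    case False
    then have "E a * P ys = P ys" using Cons by simp
    moreover have "E a * (E c * P ys) = E c * (E a * P ys)"
      by (metis E_commute mult.assoc)
    ultimately show ?thesis by simp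
  qed
qed simp

lemma P_P_absorb:
  "\<forall>a\<in>set xs. \<exists>b\<in>set ys. int n dvd a - b \<Longrightarrow> P xs * P ys = P ys"
  by (induction xs) (use E_P_absorb in \<open>auto simp: mult.assoc\<close>)

text \<open>Among commuting idempotents each of the two products absorbs the other, so they
  coincide. Thus \<open>P xs\<close> depends only on the set of residues occurring in
  \<open>xs\<close>.\<close>

lemma P_cong:
  assumes "\<And>a. (\<exists>b\<in>set xs. int n dvd a - b) \<longleftrightarrow> (\<exists>b\<in>set ys. int n dvd a - b)"
  shows "P xs = P ys"
proof -
  have "P xs * P ys = P ys"
    by (rule P_P_absorb) (metis assms diff_self dvd_0_right)
  moreover have "P ys * P xs = P xs"
    by (rule P_P_absorb) (metis assms diff_self dvd_0_right)
  ultimately show ?thesis by (metis P_commute)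
qed

text \<open>The empty map is written \<open>P xs * G k\<close> for every \<open>k\<close>, so these
  elements have to be identified. This uses that the full product absorbs g on the left; a rotation
  on the right is carried to the left, which merely permutes the complete set of residues.\<close>

lemma P_eq_zero:
  assumes "\<And>a. \<exists>b\<in>set xs. int n dvd a - b"
  shows "P xs * G k = K {}"
proof -
  have "G (int j) * K {} = K {}" for j
  proof (induction j)
    case (Suc j)
    have "G (int (Suc j)) * K {} = G (int j) * (G 1 * K {})"
      by (simp add: G_mult_left add.commute)
    then show ?case using Suc conjugate_relationsD by simp
  qed simp
  then have zero: "G k * K {} = K {}"
    by (metis G_def pow_eq_G)
  have "P xs = K {}"
    by (rule P_cong) (use assms in \<open>simp add: in_complement_list_iff\<close>)
  then have "P xs * G k = G k * P (map (\<lambda>a. a + k) (complement_list {}))"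
    by (simp add: P_G)
  also have "P (map (\<lambda>a. a + k) (complement_list {})) = K {}"
  proof (rule P_cong)
    fix a
    have "\<exists>b\<in>set (complement_list {}). int n dvd (a - k) - b"
      by (simp add: in_complement_list_iff)
    then show "(\<exists>b\<in>set (map (\<lambda>a. a + k) (complement_list {})). int n dvd a - b) \<longleftrightarrow>
        (\<exists>b\<in>set (complement_list {}). int n dvd a - b)"
      by (auto simp: in_complement_list_iff algebra_simps)
  qed
  finally show ?thesis using zero by simp
qed

text \<open>In the action on points these elements are the restricted rotations.\<close>

definition rotational :: "'a \<Rightarrow> bool" where
  "rotational c \<longleftrightarrow> (\<exists>xs k. c = P xs * G k)"

lemma rotationalI: "rotational (P xs)" "rotational (G k)" "rotational (E k)"
  unfolding rotational_def
  by (rule exI [of _ xs], rule exI [of _ 0], simp)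
    (rule exI [of _ "[]"], rule exI [of _ k], simp,
     rule exI [of _ "[k]"], rule exI [of _ 0], simp)

lemma rotational_mult: "rotational a \<Longrightarrow> rotational b \<Longrightarrow> rotational (a * b)"
proof -
  assume "rotational a" "rotational b"
  then obtain xs k ys l where "a = P xs * G k" "b = P ys * G l"
    unfolding rotational_def by blast
  then have "a * b = P xs * (G k * P ys) * G l" by (simp add: mult.assoc)
  also have "\<dots> = P (xs @ map (\<lambda>a. a - k) ys) * G (k + l)"
    by (simp only: G_P) (simp add: mult.assoc G_mult)
  finally show ?thesis unfolding rotational_def by blast
qed

context
  fixes i
  assumes i: "i \<in> {1..m}"
begin

text \<open>Deleting either point of the domain of x_i leaves a map of rank one. The explicit shape,
  rather than just \<open>rotational\<close>, is kept because a later step needs to know that only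
  one residue survives.\<close>

lemma E_x_rank_one:
  assumes "int n dvd k \<or> int n dvd k - int i"
  shows "\<exists>c e. E k * x i = G c * K {e}"
  using assms
proof
  assume "int n dvd k"
  then have "E k = E 0" using E_cong by simp
  then show ?thesis using i conjugate_relationsD by metis
next
  assume "int n dvd k - int i"
  then have "E k = E (int i)" using E_cong by blast
  then have "E k * x i = G 0 * K {0}" using i conjugate_relationsD by simp
  then show ?thesis by blast
qed

lemma x_E_rotational:
  assumes "int n dvd k \<or> int n dvd k + int i"
  shows "rotational (x i * E k)"
proof -
  have "E k = E 0 \<or> E k = E (- int i)"
    using assms E_cong [of k 0] E_cong [of k "- int i"] by auto
  moreover have "x i * E 0 = G (- 2 * int i) * K {n - i}" "x i * E (- int i) = K {0}"
    using i conjugate_relationsD by auto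
  ultimately show ?thesis
    using rotational_mult rotationalI by metis
qed

lemma x_E_cases: "x i * E k = x i \<or> rotational (x i * E k)"
  using i conjugate_relationsD x_E_rotational by metis

lemma E_x_cases: "E k * x i = x i \<or> rotational (E k * x i)"
  using i conjugate_relationsD E_x_rank_one rotational_mult rotationalI by metis

lemma P_x_cases: "P xs * x i = x i \<or> rotational (P xs * x i)"
proof (induction xs)
  case (Cons a xs)
  then show ?case
  proof
    assume "P xs * x i = x i"
    then show ?thesis using E_x_cases by (simp add: mult.assoc)
  next
    assume "rotational (P xs * x i)"
    then show ?thesis using rotational_mult rotationalI by (simp add: mult.assoc)
  qed
qed simp

lemma x_P_rotational:
  assumes "a \<in> set xs" "int n dvd a \<or> int n dvd a + int i"
  shows "rotational (x i * P xs)"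
proof -
  have "x i * P xs = x i * E a * P xs"
    using E_P_absorb [OF assms(1)] by (simp add: mult.assoc)
  then show ?thesis
    using x_E_rotational [OF assms(2)] rotational_mult rotationalI by metis
qed

end

text \<open>The image of x_i followed by g^b is {b, b - i}, the domain of x_j is {0, j}. They agree
  modulo n only if i = j and b = i, because the alternative b = 0, j = -i contradicts 0 < i + j < n.
  If they differ, the product has rank at most one and a point can be deleted from the
  middle.\<close>

lemma x_G_x_rotational:
  assumes i: "i \<in> {1..m}" and j: "j \<in> {1..m}"
  shows "rotational (x i * G b * x j)"
proof (cases "i = j \<and> int n dvd b - int i")
  case True
  then have "G b = G (int i)" by (intro G_cong) blast
  then have "x i * G b * x j = x i * G (int i) * (x i * G (int i)) * G (- int i)"
    using True by (simp add: mult.assoc G_mult)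
  also have "\<dots> = K {0, i} * G (- int i)" using i conjugate_relationsD by simp
  finally show ?thesis unfolding rotational_def by blast
next
  case False
  have nd: "\<not> int n dvd k" if "k \<noteq> 0" "\<bar>k\<bar> < int n" for k using dvd_imp_zero that by blast
  have bounds: "1 \<le> i" "2 * i < n" "1 \<le> j" "2 * j < n"
    using index_bound i j by auto
  \<comment> \<open>The witness is a residue in the domain of x_j that is not reached by x_i
    followed by g^b.\<close>
  have "\<exists>y\<in>{0, int j}. \<not> int n dvd y - b \<and> \<not> int n dvd y - b + int i"
  proof (rule ccontr)
    assume "\<not> ?thesis"
    then have 0: "int n dvd - b \<or> int n dvd - b + int i"
      and 1: "int n dvd int j - b \<or> int n dvd int j - b + int i" by auto
    from 0 show False
    proof
      assume b: "int n dvd - b"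
      from 1 have "int n dvd (int j - b) - (- b) \<or> int n dvd (int j - b + int i) - (- b)"
        using b dvd_diff by metis
      then show False using nd [of "int j"] nd [of "int j + int i"] bounds by auto
    next
      assume b: "int n dvd - b + int i"
      from 1 have "int n dvd (int j - b) - (- b + int i) \<or> int n dvd (int j - b + int i) - (- b + int i)"
        using b dvd_diff by metis
      then have "int n dvd int j - int i \<or> int n dvd int j"
        by simp
      moreover have "\<bar>int j - int i\<bar> < int n" "\<not> int n dvd int j"
        using bounds nd [of "int j"] by auto
      ultimately have "i = j" using nd [of "int j - int i"] by auto
      moreover have "int n dvd b - int i" using b by (metis dvd_minus_iff minus_diff_eq uminus_add_conv_diff)
      ultimately show False using False by simp
    qed
  qed
  then obtain y where y: "y = 0 \<or> y = int j" "\<not> int n dvd y - b" "\<not> int n dvd y - b + int i"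
    by blast
  obtain c e where ce: "E y * x j = G c * K {e}"
    using E_x_rank_one [OF j, of y] y(1) by auto
  \<comment> \<open>The inserted idempotent costs nothing on the side of x_i; once carried past the
    rotation it becomes \<open>E y\<close> and deletes a point of the domain of x_j.\<close>
  have "x i = x i * E (y - b)" using y i conjugate_relationsD by metis
  then have "x i * G b * x j = x i * (E (y - b) * G b) * x j" by (metis mult.assoc)
  also have "\<dots> = x i * G b * (E y * x j)" by (simp add: E_G mult.assoc)
  also have "\<dots> = x i * (G (b + c) * K {e})" by (simp add: ce mult.assoc G_mult_left)
  also have "\<dots> = x i * P (map (\<lambda>a. a - (b + c)) (complement_list {e})) * G (b + c)"
    by (simp add: G_P mult.assoc)
  finally have eq: "x i * G b * x j = \<dots>" .
  define d where "d = b + c"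
  \<comment> \<open>After the shift by \<open>d\<close>, the images 0 and -i of x_i correspond to
    the residues \<open>d\<close> and \<open>d - i\<close>. They are distinct, so
    \<open>K {e}\<close> deletes at least one of them, and x_i collapses to a rotational
    element.\<close>
  have "d mod int n \<noteq> (d - int i) mod int n"
    using nd [of "int i"] bounds by (simp add: mod_eq_dvd_iff)
  moreover have "0 \<le> d mod int n" "0 \<le> (d - int i) mod int n" using n_pos by simp_all
  ultimately have "nat (d mod int n) \<noteq> e \<or> nat ((d - int i) mod int n) \<noteq> e"
    by linarith
  then have "(\<exists>z\<in>set (complement_list {e}). int n dvd d - z) \<or>
      (\<exists>z\<in>set (complement_list {e}). int n dvd d - int i - z)"
    by (simp add: in_complement_list_iff)
  then obtain z where z: "z \<in> set (complement_list {e})" "int n dvd d - z \<or> int n dvd d - int i - z"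
    by blast
  have "rotational (x i * P (map (\<lambda>a. a - d) (complement_list {e})))"
  proof (rule x_P_rotational [OF i])
    show "z - d \<in> set (map (\<lambda>a. a - d) (complement_list {e}))" using z by simp
    show "int n dvd z - d \<or> int n dvd z - d + int i"
      using z(2) dvd_minus_iff [of "int n" "d - z"] dvd_minus_iff [of "int n" "d - int i - z"]
      by (simp add: algebra_simps)
  qed
  then show ?thesis unfolding eq d_def using rotational_mult rotationalI by blast
qed

definition normal :: "'a \<Rightarrow> bool" where
  "normal c \<longleftrightarrow> rotational c \<or> (\<exists>a b. \<exists>i\<in>{1..m}. c = G a * x i * G b)"

text \<open>Words are built by appending letters, so only products with one letter arise. The cases
  with content are idempotents meeting x_j on the left, e_1 meeting x_i on the right, and two
  reflections separated by a rotation.\<close>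

lemma normal_mult_letter:
  assumes "normal c" "l \<in> alphabet m"
  shows "normal (c * f l)"
proof -
  have one: "G 1 = f Gen_g" using pow_eq_G [of 1] by simp
  consider (rot) xs k where "c = P xs * G k" | (ref) a i b where "i \<in> {1..m}" "c = G a * x i * G b"
    using assms(1) unfolding normal_def rotational_def by blast
  then show ?thesis
  proof cases
    case rot
    then have rc: "rotational c" unfolding rotational_def by blast
    consider "l = Gen_g" | "l = Gen_e1" | j where "l = Gen_x j" "j \<in> {1..m}"
      using assms(2) unfolding alphabet_def by blast
    then show ?thesis
    proof cases
      case 1
      then show ?thesis using rotational_mult [OF rc rotationalI(2) [of 1]] by (simp add: normal_def one)
    next
      case 2
      then show ?thesis using rotational_mult [OF rc rotationalI(3) [of 0]] by (simp add: normal_def e_eq_E)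
    next
      case 3
      have "c * f l = G k * (P (map (\<lambda>a. a + k) xs) * x j)"
        using rot 3 by (simp add: P_G mult.assoc)
      moreover from P_x_cases [OF 3(2)]
      have "normal (G k * (P (map (\<lambda>a. a + k) xs) * x j))"
      proof
        assume "P (map (\<lambda>a. a + k) xs) * x j = x j"
        then have "G k * (P (map (\<lambda>a. a + k) xs) * x j) = G k * x j * G 0" by simp
        then show ?thesis using 3 unfolding normal_def by blast
      qed (simp add: normal_def rotational_mult rotationalI)
      ultimately show ?thesis by simp
    qed
  next
    case ref
    consider "l = Gen_g" | "l = Gen_e1" | j where "l = Gen_x j" "j \<in> {1..m}"
      using assms(2) unfolding alphabet_def by blast
    then show ?thesis
    proof cases
      case 1
      then have "c * f l = G a * x i * G (b + 1)"
        by (simp add: ref G_mult mult.assoc flip: one)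
      then show ?thesis using ref unfolding normal_def by blast
    next
      case 2
      then have eq: "c * f l = G a * (x i * E (- b)) * G b"
        by (simp add: ref G_E mult.assoc e_eq_E)
      from x_E_cases [OF ref(1)] show ?thesis
      proof
        assume "x i * E (- b) = x i"
        then have "c * f l = G a * x i * G b" using eq by simp
        then show ?thesis using ref(1) unfolding normal_def by blast
      next
        assume "rotational (x i * E (- b))"
        then show ?thesis unfolding eq normal_def using rotational_mult rotationalI by blast
      qed
    next
      case 3
      then have eq: "c * f l = G a * (x i * G b * x j)"
        by (simp add: ref mult.assoc)
      then show ?thesis
        unfolding eq normal_def using x_G_x_rotational ref 3 rotational_mult rotationalI by blast
    qed
  qed
qed

lemma normal_word_val: "w \<in> lists (alphabet m) \<Longrightarrow> normal (word_val f w)"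
proof (induction w rule: rev_induct)
  case Nil
  then show ?case using rotationalI(1) [of "[]"] by (simp add: normal_def)
next
  case (snoc l w)
  then show ?case using normal_mult_letter by simp
qed

lemma ex_normal_word:
  assumes "w \<in> lists (alphabet m)"
  shows "\<exists>v\<in>normal_words n m. word_val f w = word_val f v"
  using normal_word_val [OF assms] unfolding normal_def
proof
  assume "rotational (word_val f w)"
  then obtain xs k where "word_val f w = P xs * G k"
    unfolding rotational_def by blast
  then show ?thesis
    by (intro bexI [of _ "idempotent_word n xs @ rotation_word n k"]) (auto simp: normal_words_def)
next
  assume "\<exists>a b. \<exists>i\<in>{1..m}. word_val f w = G a * x i * G b"
  then obtain a b i where "i \<in> {1..m}" "word_val f w = G a * x i * G b" by blast
  then have "word_val f w = word_val f (rotation_word n a @ xw i @ rotation_word n b)"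
    by (simp add: mult.assoc)
  moreover have "rotation_word n a @ xw i @ rotation_word n b \<in> normal_words n m"
    unfolding normal_words_def using \<open>i \<in> {1..m}\<close> by blast
  ultimately show ?thesis by blast
qed

end

section \<open>Presentations and the right regular representation\<close>

lemma monoid_congruence_free_monoid:
  "monoid_congruence (free_monoid A) \<rho> \<longleftrightarrow> equiv (lists A) \<rho> \<and>
     (\<forall>a b c d. (a, b) \<in> \<rho> \<longrightarrow> (c, d) \<in> \<rho> \<longrightarrow> (a @ c, b @ d) \<in> \<rho>)"
  by (simp add: monoid_congruence_def free_monoid_def)

lemma monoid_congruence_kernel:
  "monoid_congruence (free_monoid A)
     {(u, v). u \<in> lists A \<and> v \<in> lists A \<and> word_val f u = word_val f v}"
  unfolding monoid_congruence_free_monoid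
  by (auto intro!: equivI refl_onI symI transI)

lemma monoid_congruence_generated:
  assumes "Q \<subseteq> lists A \<times> lists A"
  shows "monoid_congruence (free_monoid A) (generated_congruence (free_monoid A) Q)"
    (is "monoid_congruence _ ?\<rho>")
proof -
  define C where "C = {\<rho>. monoid_congruence (free_monoid A) \<rho> \<and> Q \<subseteq> \<rho>}"
  \<comment> \<open>The total congruence shows that the family is nonempty; without a member, the
    intersection would contain all pairs of lists, including those outside
    \<open>lists A\<close>.\<close>
  have "lists A \<times> lists A \<in> C"
    using assms by (auto simp: C_def monoid_congruence_free_monoid intro!: equivI refl_onI symI transI)
  then have sub: "\<Inter> C \<subseteq> lists A \<times> lists A" by blast
  have eq: "refl_on (lists A) \<rho>" "sym \<rho>" "trans \<rho>" if "\<rho> \<in> C" for \<rho>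
    using that by (auto simp: C_def monoid_congruence_free_monoid equiv_def)
  have "refl_on (lists A) (\<Inter> C)"
    using eq(1) unfolding refl_on_def by blast
  moreover have "sym (\<Inter> C)"
    using eq(2) unfolding sym_def by blast
  moreover have "trans (\<Inter> C)"
    using eq(3) unfolding trans_def by blast
  ultimately have "equiv (lists A) (\<Inter> C)" using sub by (simp add: equiv_def)
  moreover have "(a @ c, b @ d) \<in> \<Inter> C" if "(a, b) \<in> \<Inter> C" "(c, d) \<in> \<Inter> C" for a b c d
    using that unfolding C_def monoid_congruence_free_monoid by blast
  ultimately show ?thesis
    unfolding monoid_congruence_free_monoid generated_congruence_def C_def by blast
qed

lemma generated_congruence_subset: "Q \<subseteq> generated_congruence M Q"
  by (auto simp: generated_congruence_def)

lemma generated_congruence_least: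
  "monoid_congruence M \<rho> \<Longrightarrow> Q \<subseteq> \<rho> \<Longrightarrow> generated_congruence M Q \<subseteq> \<rho>"
  by (auto simp: generated_congruence_def)

text \<open>The right regular representation of the quotient of the free monoid by \<open>\<rho>\<close>; sets that are
  not classes are fixed, so that the empty word acts as the identity.\<close>

definition regular_rep :: "'b set \<Rightarrow> ('b list \<times> 'b list) set \<Rightarrow> 'b \<Rightarrow> 'b list set endo" where
  "regular_rep A \<rho> l =
     Endo (\<lambda>X. if X \<in> lists A // \<rho> then (\<Union>w\<in>X. \<rho> `` {w @ [l]}) else X)"

lemma regular_rep_class:
  assumes "monoid_congruence (free_monoid A) \<rho>" "u \<in> lists A" "w \<in> lists A"
  shows "apply_endo (word_val (regular_rep A \<rho>) w) (\<rho> `` {u}) = \<rho> `` {u @ w}"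
  using assms(2,3)
proof (induction w arbitrary: u)
  case (Cons l w)
  have eq: "equiv (lists A) \<rho>" using assms(1) by (simp add: monoid_congruence_free_monoid)
  have "\<rho> `` {v @ [l]} = \<rho> `` {u @ [l]}" if "v \<in> \<rho> `` {u}" for v
  proof -
    have "(u, v) \<in> \<rho>" "([l], [l]) \<in> \<rho>"
      using that eq Cons.prems by (auto simp: equiv_def refl_on_def)
    then have "(u @ [l], v @ [l]) \<in> \<rho>"
      using assms(1) unfolding monoid_congruence_free_monoid by blast
    then show ?thesis using equiv_class_eq [OF eq] by blast
  qed
  moreover have "u \<in> \<rho> `` {u}" using eq Cons.prems by (auto simp: equiv_def refl_on_def)
  ultimately have "(\<Union>v\<in>\<rho> `` {u}. \<rho> `` {v @ [l]}) = \<rho> `` {u @ [l]}"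
    by blast
  then have "apply_endo (regular_rep A \<rho> l) (\<rho> `` {u}) = \<rho> `` {u @ [l]}"
    using Cons.prems by (simp add: regular_rep_def Endo_inverse quotientI)
  then show ?case using Cons by simp
qed simp

lemma regular_rep_non_class:
  "X \<notin> lists A // \<rho> \<Longrightarrow> apply_endo (word_val (regular_rep A \<rho>) w) X = X"
  by (induction w) (simp_all add: regular_rep_def Endo_inverse)

text \<open>The representation is faithful because a word sends the class of the empty word to its
  own class. Statements about \<open>monoid_mult\<close> thereby become statements about the
  presented monoid.\<close>

lemma word_val_regular_rep_eq_iff:
  assumes "monoid_congruence (free_monoid A) \<rho>" "u \<in> lists A" "v \<in> lists A"
  shows "word_val (regular_rep A \<rho>) u = word_val (regular_rep A \<rho>) v \<longleftrightarrow> (u, v) \<in> \<rho>"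
proof
  have eq: "equiv (lists A) \<rho>" using assms(1) by (simp add: monoid_congruence_free_monoid)
  show "(u, v) \<in> \<rho>" if "word_val (regular_rep A \<rho>) u = word_val (regular_rep A \<rho>) v"
    using that regular_rep_class [OF assms(1), of "[]"] assms(2,3) eq_equiv_class_iff [OF eq]
    by (metis append_Nil lists.Nil)
  show "word_val (regular_rep A \<rho>) u = word_val (regular_rep A \<rho>) v" if "(u, v) \<in> \<rho>"
  proof (rule endo_eqI)
    fix X
    show "apply_endo (word_val (regular_rep A \<rho>) u) X = apply_endo (word_val (regular_rep A \<rho>) v) X"
    proof (cases "X \<in> lists A // \<rho>")
      case True
      then obtain w where w: "w \<in> lists A" "X = \<rho> `` {w}" by (auto simp: quotient_def)
      then have "(w, w) \<in> \<rho>" using eq by (auto simp: equiv_def refl_on_def)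
      then have "(w @ u, w @ v) \<in> \<rho>"
        using that assms(1) unfolding monoid_congruence_free_monoid by blast
      then show ?thesis
        using w assms regular_rep_class [OF assms(1)] equiv_class_eq [OF eq] by metis
    qed (simp add: regular_rep_non_class)
  qed
qed

lemma iso_quotient_monoidI:
  assumes cong: "monoid_congruence (free_monoid A) \<rho>"
    and closed: "\<And>w. w \<in> lists A \<Longrightarrow> \<phi> w \<in> carrier M"
    and surj: "carrier M \<subseteq> \<phi> ` lists A"
    and mult: "\<And>u v. u \<in> lists A \<Longrightarrow> v \<in> lists A \<Longrightarrow> \<phi> (u @ v) = \<phi> u \<otimes>\<^bsub>M\<^esub> \<phi> v"
    and kernel: "\<And>u v. u \<in> lists A \<Longrightarrow> v \<in> lists A \<Longrightarrow> \<phi> u = \<phi> v \<longleftrightarrow> (u, v) \<in> \<rho>"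
  shows "M \<cong> quotient_monoid (free_monoid A) \<rho>"
proof -
  \<comment> \<open>The isomorphism sends an element to its fibre under \<phi>. By the kernel
    condition a fibre is exactly one congruence class, so no representatives have to be
    chosen.\<close>
  define h where "h \<alpha> = {w \<in> lists A. \<alpha> = \<phi> w}" for \<alpha>
  have eq: "equiv (lists A) \<rho>" using cong by (simp add: monoid_congruence_free_monoid)
  then have sub: "\<rho> \<subseteq> lists A \<times> lists A" by (simp add: equiv_type)
  have h: "h (\<phi> w) = \<rho> `` {w}" if "w \<in> lists A" for w
  proof (rule Set.set_eqI)
    fix v
    show "v \<in> h (\<phi> w) \<longleftrightarrow> v \<in> \<rho> `` {w}"
      using that kernel [of w v] sub
        by (cases "v \<in> lists A") (auto simp: h_def simp del: in_lists_conv_set)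
  qed
  have "h (\<alpha> \<otimes>\<^bsub>M\<^esub> \<beta>) = (\<Union>x\<in>h \<alpha>. \<Union>y\<in>h \<beta>. \<rho> `` {x @ y})"
    if carrier: "\<alpha> \<in> carrier M" "\<beta> \<in> carrier M" for \<alpha> \<beta>
  proof -
    obtain u v where uv: "u \<in> lists A" "v \<in> lists A" "\<alpha> = \<phi> u" "\<beta> = \<phi> v"
      using carrier surj by blast
    have "\<rho> `` {x @ y} = h (\<alpha> \<otimes>\<^bsub>M\<^esub> \<beta>)" if "x \<in> h \<alpha>" "y \<in> h \<beta>" for x y
      using that h [of "x @ y"] mult by (auto simp: h_def)
    moreover have "u \<in> h \<alpha>" "v \<in> h \<beta>" using uv by (auto simp: h_def)
    ultimately show ?thesis by blast
  qed
  moreover have h_class: "h \<alpha> \<in> lists A // \<rho>" if \<alpha>: "\<alpha> \<in> carrier M" for \<alpha>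
  proof -
    obtain w where "w \<in> lists A" "\<alpha> = \<phi> w" using \<alpha> surj by blast
    then show ?thesis by (simp add: h quotientI)
  qed
  ultimately have "h \<in> hom M (quotient_monoid (free_monoid A) \<rho>)"
    by (auto simp: hom_def quotient_monoid_def free_monoid_def)
  moreover have "bij_betw h (carrier M) (carrier (quotient_monoid (free_monoid A) \<rho>))"
  proof (rule bij_betwI')
    fix \<alpha> \<beta> assume "\<alpha> \<in> carrier M" "\<beta> \<in> carrier M"
    then obtain u where u: "u \<in> lists A" "\<alpha> = \<phi> u" using surj by blast
    show "h \<alpha> = h \<beta> \<longleftrightarrow> \<alpha> = \<beta>"
    proof
      assume "h \<alpha> = h \<beta>"
      moreover have "u \<in> h \<alpha>" using u by (simp add: h_def)
      ultimately have "u \<in> h \<beta>" by simp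
      then show "\<alpha> = \<beta>" using u by (simp add: h_def)
    qed simp
  next
    fix \<alpha> assume "\<alpha> \<in> carrier M"
    then show "h \<alpha> \<in> carrier (quotient_monoid (free_monoid A) \<rho>)"
      using h_class by (simp add: quotient_monoid_def free_monoid_def)
  next
    fix X assume "X \<in> carrier (quotient_monoid (free_monoid A) \<rho>)"
    then obtain w where "w \<in> lists A" "X = \<rho> `` {w}"
      by (auto simp: quotient_monoid_def free_monoid_def quotient_def)
    then show "\<exists>\<alpha>\<in>carrier M. X = h \<alpha>" using h closed by blast
  qed
  ultimately show ?thesis by (auto simp: is_iso_def iso_def)
qed

section \<open>The action on points\<close>

text \<open>Points become residues counted from 0, so that rotations are translations and wrapping
  around needs no case distinction.\<close>

definition pt :: "nat \<Rightarrow> int \<Rightarrow> nat" where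
  "pt n a = nat (a mod int n) + 1"

lemma pt_eq_iff: "0 < n \<Longrightarrow> pt n a = pt n b \<longleftrightarrow> int n dvd a - b"
  by (simp add: pt_def nat_eq_iff flip: mod_eq_dvd_iff)

lemma pt_in_range: "0 < n \<Longrightarrow> pt n a \<in> {1..n}"
proof -
  assume "0 < n"
  then have "nat (a mod int n) < n" by (simp add: nat_less_iff)
  then show ?thesis by (simp add: pt_def)
qed

lemma pt_of_point: "p \<in> {1..n} \<Longrightarrow> pt n (int p - 1) = p"
  by (auto simp: pt_def)

lemma ex_pt: "p \<in> {1..n} \<Longrightarrow> \<exists>a. p = pt n a"
  using pt_of_point by metis

lemma int_pt: "0 < n \<Longrightarrow> int (pt n a) = a mod int n + 1"
  by (simp add: pt_def)

text \<open>Points outside \<open>{1..n}\<close> are fixed by every generator, so that \<open>g\<^sup>n\<close> is the identity.\<close>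

fun letter_map :: "nat \<Rightarrow> letter \<Rightarrow> nat \<Rightarrow> nat option" where
  "letter_map n Gen_g p = Some (rot_perm n p)"
| "letter_map n Gen_e1 p = (if p = 1 then None else Some p)"
| "letter_map n (Gen_x i) p =
     (if p \<notin> {1..n} \<or> p = 1 then Some p else if p = i + 1 then Some (n + 1 - i) else None)"

text \<open>Undefinedness is the sink \<open>None\<close>: partial maps become total functions,
  composed as in \<open>endo\<close>.\<close>

definition point_action :: "nat \<Rightarrow> letter \<Rightarrow> nat option endo" where
  "point_action n l = Endo (\<lambda>p. Option.bind p (letter_map n l))"

lemma apply_point_action [simp]:
  "apply_endo (point_action n l) None = None"
  "apply_endo (point_action n l) (Some p) = letter_map n l p"
  by (simp_all add: point_action_def Endo_inverse)

text \<open>These conditions hold for the values of all words over the alphabet and fix the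
  behaviour off {1..n}, so that passing to a partial map of {1..n} loses no information.\<close>

definition proper :: "nat \<Rightarrow> nat option endo \<Rightarrow> bool" where
  "proper n c \<longleftrightarrow> apply_endo c None = None \<and>
     (\<forall>p. p \<notin> {1..n} \<longrightarrow> apply_endo c (Some p) = Some p) \<and>
     (\<forall>p\<in>{1..n}. apply_endo c (Some p) \<in> insert None (Some ` {1..n}))"

lemma proper_mult:
  assumes "proper n a" "proper n b"
  shows "proper n (a * b)"
  unfolding proper_def
proof (intro conjI allI ballI impI)
  fix p assume "p \<in> {1..n}"
  then have "apply_endo a (Some p) \<in> insert None (Some ` {1..n})"
    using assms(1) unfolding proper_def by blast
  then show "apply_endo (a * b) (Some p) \<in> insert None (Some ` {1..n})"
    using assms(2) unfolding proper_def apply_endo_times by force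
qed (use assms in \<open>auto simp: proper_def\<close>)

lemma proper_word_val:
  assumes "0 < n" "w \<in> lists (alphabet m)" "2 * m < n"
  shows "proper n (word_val (point_action n) w)"
  using assms(2)
proof (induction w)
  case (Cons l w)
  have "letter_map n l p = Some p" if "p \<notin> {1..n}" for p
    using that assms(1) by (cases l) (auto simp: rot_perm_def)
  moreover have "letter_map n l p \<in> insert None (Some ` {1..n})" if "p \<in> {1..n}" for p
    using that Cons.prems assms(1,3) by (cases l) (auto simp: rot_perm_def alphabet_def image_iff)
  ultimately have "proper n (point_action n l)"
    by (simp add: proper_def)
  then show ?case
    using Cons proper_mult by simp
qed (auto simp: proper_def)

definition partial_map :: "nat \<Rightarrow> nat option endo \<Rightarrow> nat \<rightharpoonup> nat" where
  "partial_map n c = (\<lambda>p. if p \<in> {1..n} then apply_endo c (Some p) else None)"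

lemma partial_map_mult:
  assumes "proper n a" "proper n b"
  shows "partial_map n (a * b) = partial_map n b \<circ>\<^sub>m partial_map n a"
proof
  fix p
  show "partial_map n (a * b) p = (partial_map n b \<circ>\<^sub>m partial_map n a) p"
  proof (cases "p \<in> {1..n}")
    case True
    then have "apply_endo a (Some p) \<in> insert None (Some ` {1..n})"
      using assms(1) unfolding proper_def by blast
    then show ?thesis
    proof
      assume "apply_endo a (Some p) = None"
      moreover have "apply_endo b None = None" using assms(2) unfolding proper_def by blast
      ultimately show ?thesis using True by (simp add: partial_map_def map_comp_def)
    next
      assume "apply_endo a (Some p) \<in> Some ` {1..n}"
      then obtain q where q: "apply_endo a (Some p) = Some q" "q \<in> {1..n}" by blast
      then show ?thesis using True by (simp add: partial_map_def map_comp_def)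
    qed
  next
    case False
    then show ?thesis by (simp only: partial_map_def map_comp_def if_False option.case)
  qed
qed

lemma proper_eqI:
  assumes "proper n c" "proper n d"
    and "\<And>a. apply_endo c (Some (pt n a)) = apply_endo d (Some (pt n a))"
  shows "c = d"
proof (rule endo_eqI)
  fix p show "apply_endo c p = apply_endo d p"
  proof (cases p)
    case (Some q)
    then show ?thesis
      using assms ex_pt [of q n] by (cases "q \<in> {1..n}") (auto simp: proper_def)
  qed (use assms in \<open>simp add: proper_def\<close>)
qed

lemma partial_map_inject:
  assumes "0 < n" "proper n c" "proper n d" "partial_map n c = partial_map n d"
  shows "c = d"
proof (rule proper_eqI [OF assms(2,3)])
  fix a
  show "apply_endo c (Some (pt n a)) = apply_endo d (Some (pt n a))"
    using fun_cong [OF assms(4), of "pt n a"] pt_in_range [OF assms(1), of a]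
    by (simp only: partial_map_def if_True)
qed

lemma rot_perm_pt: "0 < n \<Longrightarrow> rot_perm n (pt n a) = pt n (a + 1)"
proof -
  assume n: "0 < n"
  show ?thesis
  proof (cases "pt n a = n")
    case True
    then have "a mod int n = int n - 1" using int_pt [OF n, of a] by simp
    then have "(a + 1) mod int n = 0" by (metis diff_add_cancel mod_add_left_eq mod_self)
    then show ?thesis using True n by (simp add: rot_perm_def pt_def)
  next
    case False
    then have "pt n a < n" using pt_in_range [OF n, of a] by simp
    then have "a mod int n + 1 < int n" using int_pt [OF n, of a] by simp
    then have "(a mod int n + 1) mod int n = a mod int n + 1" using n by (simp add: mod_pos_pos_trivial)
    then have "(a + 1) mod int n = a mod int n + 1" by (simp add: mod_simps)
    then show ?thesis
      using False pt_in_range [OF n, of a] n by (simp add: rot_perm_def pt_def nat_add_distrib)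
  qed
qed

text \<open>The image \<open>n + 1 - i\<close> of the point \<open>i + 1\<close> has residue -i, so
  x_i is a -> -a on the residues 0 and i.\<close>

lemma letter_map_pt:
  assumes "0 < n"
  shows "letter_map n Gen_g (pt n a) = Some (pt n (a + 1))"
    "letter_map n Gen_e1 (pt n a) = (if int n dvd a then None else Some (pt n a))"
    "1 \<le> i \<Longrightarrow> i < n \<Longrightarrow> letter_map n (Gen_x i) (pt n a) =
       (if int n dvd a then Some (pt n 0) else if int n dvd a - int i then Some (pt n (- int i)) else None)"
proof -
  show "letter_map n Gen_g (pt n a) = Some (pt n (a + 1))"
    using assms by (simp add: rot_perm_pt)
  have one: "pt n a = 1 \<longleftrightarrow> int n dvd a"
    using pt_eq_iff [OF assms, of a 0] by (simp add: pt_def)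
  then show "letter_map n Gen_e1 (pt n a) = (if int n dvd a then None else Some (pt n a))"
    by simp
  show "letter_map n (Gen_x i) (pt n a) =
       (if int n dvd a then Some (pt n 0) else if int n dvd a - int i then Some (pt n (- int i)) else None)"
    if "1 \<le> i" "i < n"
  proof -
    have "pt n (int i) = i + 1" "pt n 0 = 1"
      using that by (simp_all add: pt_def mod_pos_pos_trivial)
    moreover have "(- int i) mod int n = int n - int i"
      using that by (simp add: zmod_zminus1_eq_if mod_pos_pos_trivial)
    then have "pt n (- int i) = n + 1 - i"
      using that by (simp add: pt_def nat_diff_distrib)
    ultimately show ?thesis
      using one pt_eq_iff [OF assms, of a "int i"] pt_in_range [OF assms, of a] by auto
  qed
qed

section \<open>The action on points satisfies the relations\<close>

locale point_model =
  fixes n m :: nat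
  assumes n_ge_4: "4 \<le> n" and m_eq: "m = (n - 1) div 2"
begin

lemma n_pos: "0 < n"
  using n_ge_4 by simp

lemma two_m_less: "2 * m < n"
  using n_ge_4 by (auto simp: m_eq)

lemma pow_point_action:
  "apply_endo (point_action n Gen_g ^ k) (Some (pt n a)) = Some (pt n (a + int k))"
  by (induction k arbitrary: a) (simp_all add: rot_perm_pt [OF n_pos] add_ac)

lemma rotation_model: "rotation_model n (point_action n)"
proof
  show "0 < n" by (rule n_pos)
  have "proper n (word_val (point_action n) (gw \<up> n))"
    by (rule proper_word_val [OF n_pos _ two_m_less])
      (auto simp: word_pow_def alphabet_def)
  moreover have "proper n 1" by (auto simp: proper_def)
  ultimately show "point_action n Gen_g ^ n = 1"
    by (intro proper_eqI [of n]) (simp_all add: pow_point_action pt_eq_iff [OF n_pos])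
qed

end

sublocale point_model \<subseteq> S: rotation_model n "point_action n"
  by (rule rotation_model)

context point_model
begin

lemma proper_G: "proper n (S.G k)" and proper_P: "proper n (S.P xs)"
proof -
  have "rotation_word n k @ [] \<in> normal_words n m" "idempotent_word n xs @ rotation_word n 0 \<in> normal_words n m"
    unfolding normal_words_def by (force simp: idempotent_word_def intro: exI [of _ "[]"])+
  then have "proper n (word_val (point_action n) (rotation_word n k @ []))"
    "proper n (word_val (point_action n) (idempotent_word n xs @ rotation_word n 0))"
    using proper_word_val [OF n_pos _ two_m_less] normal_words_in_lists by blast+
  then show "proper n (S.G k)" "proper n (S.P xs)" by simp_all
qed

lemma proper_E: "proper n (S.E k)"
  using proper_P [of "[k]"] by simp

lemma proper_x: "i \<in> {1..m} \<Longrightarrow> proper n (S.x i)"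
  using proper_word_val [OF n_pos _ two_m_less, of "xw i"] by (simp add: alphabet_def)

lemmas proper_intros = proper_mult proper_G proper_P proper_E proper_x

lemma act_G [simp]: "apply_endo (S.G k) (Some (pt n a)) = Some (pt n (a + k))"
  unfolding S.G_def pow_point_action using n_pos
  by (simp add: pt_eq_iff mod_eq_dvd_iff [symmetric] mod_simps)

lemma proper_None: "proper n c \<Longrightarrow> apply_endo c None = None"
  by (simp add: proper_def)

lemma act_None [simp]:
  "apply_endo (S.G k) None = None" "apply_endo (S.P xs) None = None" "apply_endo (S.E k) None = None"
  using proper_None proper_intros by auto

lemma act_E [simp]:
  "apply_endo (S.E k) (Some (pt n a)) = (if int n dvd a - k then None else Some (pt n a))"
  unfolding S.E_def using letter_map_pt(2) [OF n_pos, of "a - k"] by simp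

lemma act_P [simp]:
  "apply_endo (S.P xs) (Some (pt n a)) =
     (if \<exists>b\<in>set xs. int n dvd a - b then None else Some (pt n a))"
  by (induction xs) auto

lemma act_x [simp]:
  "i \<in> {1..m} \<Longrightarrow> apply_endo (S.x i) (Some (pt n a)) =
     (if int n dvd a then Some (pt n 0) else if int n dvd a - int i then Some (pt n (- int i)) else None)"
  using letter_map_pt(3) [OF n_pos, of i a] two_m_less by auto

declare apply_point_action(2) [simp del]

lemma mod_eq_nat_iff: "c < n \<Longrightarrow> nat (a mod int n) = c \<longleftrightarrow> int n dvd a - int c"
  using n_pos by (auto simp: nat_eq_iff mod_eq_dvd_iff [symmetric] mod_pos_pos_trivial)

lemma act_K:
  "apply_endo (S.K C) (Some (pt n a)) = (if nat (a mod int n) \<in> C then Some (pt n a) else None)"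
  by (simp add: S.in_complement_list_iff)

text \<open>The second claim keeps the two families of normal forms apart: if n divided 2 i, then i
  = -i modulo n and x_i would be a restricted identity.\<close>

lemma not_dvd:
  assumes "i \<in> {1..m}"
  shows "\<not> int n dvd int i" "\<not> int n dvd 2 * int i"
  using S.dvd_imp_zero [of "int i"] S.dvd_imp_zero [of "2 * int i"] assms two_m_less by auto

lemma conjugate_relations_point_action: "S.conjugate_relations m"
  unfolding S.conjugate_relations_def
proof (intro conjI ballI allI impI)
  show "S.E 0 * S.E 0 = S.E 0" "S.E a * S.E b = S.E b * S.E a" for a b
    by (rule proper_eqI [of n]; simp add: proper_intros)+
  show "S.G 1 * S.K {} = S.K {}"
    by (rule proper_eqI [of n]) (simp_all add: proper_intros act_K del: act_P)
  fix i assume i: "i \<in> {1..m}"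
  note nd = not_dvd [OF i]
  have lt: "i < n" "n - i < n" using i two_m_less by auto
  show "S.E 0 * S.x i = S.x i * S.E 0"
    by (rule proper_eqI [of n]) (use i nd in \<open>simp_all add: proper_intros\<close>)
  show "S.x i * S.E k = S.x i" if "\<not> int n dvd k" "\<not> int n dvd k + int i" for k
  proof -
    have "- int i - k = - (k + int i)" by simp
    then have "\<not> int n dvd - int i - k"
      using that by (simp only: dvd_minus_iff not_False_eq_True)
    then show ?thesis
      by (intro proper_eqI [of n]) (use that i nd in \<open>simp_all add: proper_intros\<close>)
  qed
  show "S.E k * S.x i = S.x i" if "\<not> int n dvd k" "\<not> int n dvd k - int i" for k
  proof (rule proper_eqI [of n])
    fix a
    have "\<not> int n dvd a \<and> \<not> int n dvd a - int i" if "int n dvd a - k"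
      using that \<open>\<not> int n dvd k\<close> \<open>\<not> int n dvd k - int i\<close>
        dvd_diff [of "int n" a "a - k"] dvd_diff [of "int n" "a - int i" "a - k"] by auto
    then show "apply_endo (S.E k * S.x i) (Some (pt n a)) = apply_endo (S.x i) (Some (pt n a))"
      using i proper_x [OF i] by (auto simp: proper_def)
  qed (use i in \<open>simp_all add: proper_intros\<close>)
  have disjoint: "\<not> (int n dvd a \<and> int n dvd a - int i)" for a
    using nd(1) dvd_diff [of "int n" a "a - int i"] by auto
  show "S.x i * S.E (- int i) = S.E (int i) * S.x i"
    by (rule proper_eqI [of n])
      (use i nd disjoint in \<open>auto simp: proper_intros proper_None [OF proper_x]\<close>)
  note x_None = proper_None [OF proper_x [OF i]]
  show "S.E (int i) * S.x i = S.K {0}"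
  proof (rule proper_eqI [of n])
    fix a
    have "nat (a mod int n) = 0 \<longleftrightarrow> int n dvd a"
      using mod_eq_nat_iff [OF n_pos, of a] by simp
    then show "apply_endo (S.E (int i) * S.x i) (Some (pt n a)) = apply_endo (S.K {0}) (Some (pt n a))"
      using i disjoint [of a] x_None
      by (simp add: act_K pt_eq_iff [OF n_pos] del: act_P nat_0_iff)
  qed (use i in \<open>simp_all add: proper_intros\<close>)
  show "S.x i * S.E 0 = S.G (- 2 * int i) * S.K {n - i}"
  proof (rule proper_eqI [of n])
    fix a
    have e: "a + - 2 * int i - int (n - i) = (a - int i) - int n"
      using lt by (simp add: of_nat_diff)
    have "int n dvd (a - int i) - int n \<longleftrightarrow> int n dvd a - int i"
      by (metis dvd_add_right_iff dvd_refl add_uminus_conv_diff add.commute dvd_minus_iff)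
    then have "nat ((a + - 2 * int i) mod int n) = n - i \<longleftrightarrow> int n dvd a - int i"
      unfolding mod_eq_nat_iff [OF lt(2)] e .
    then show "apply_endo (S.x i * S.E 0) (Some (pt n a)) =
        apply_endo (S.G (- 2 * int i) * S.K {n - i}) (Some (pt n a))"
      using i nd disjoint [of a] dvd_minus_iff [of "int n" "a - int i"]
      by (auto simp: act_K pt_eq_iff [OF n_pos] simp del: act_P)
  qed (use i in \<open>simp_all add: proper_intros\<close>)
  show "S.x i * S.G (int i) * (S.x i * S.G (int i)) = S.K {0, i}"
  proof (rule proper_eqI [of n])
    fix a
    have "nat (a mod int n) \<in> {0, i} \<longleftrightarrow> int n dvd a \<or> int n dvd a - int i"
      using mod_eq_nat_iff [OF lt(1), of a] mod_eq_nat_iff [OF n_pos, of a] by auto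
    then show "apply_endo (S.x i * S.G (int i) * (S.x i * S.G (int i))) (Some (pt n a)) =
        apply_endo (S.K {0, i}) (Some (pt n a))"
      using i nd x_None dvd_minus_iff [of "int n" a] dvd_minus_iff [of "int n" "a - int i"]
      by (auto simp: act_K pt_eq_iff [OF n_pos] simp del: act_P)
  qed (use i in \<open>simp_all add: proper_intros\<close>)
qed

lemma relation_model: "relation_model n (point_action n) m"
  by unfold_locales
    (use n_ge_4 m_eq conjugate_relations_point_action S.satisfies_relations_iff in auto)

end

section \<open>Dihedral permutations and orientation\<close>

text \<open>The affine map a -> s a + c on residues; the dihedral group consists of those with s = 1
  or s = -1. Here g is (1, 1), and h is (-1, -1) because n + 1 - p has residue -(p - 1) - 1.\<close>

definition dihedral_map :: "nat \<Rightarrow> int \<Rightarrow> int \<Rightarrow> nat \<Rightarrow> nat" where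
  "dihedral_map n s c p = (if p \<in> {1..n} then pt n (s * (int p - 1) + c) else p)"

lemma dihedral_map_outside: "p \<notin> {1..n} \<Longrightarrow> dihedral_map n s c p = p"
  by (simp only: dihedral_map_def if_False)

lemma dihedral_map_pt:
  assumes "0 < n"
  shows "dihedral_map n s c (pt n a) = pt n (s * a + c)"
proof -
  have "(s * (a mod int n) + c) mod int n = (s * a + c) mod int n"
    by (metis mod_add_left_eq mod_mult_right_eq)
  then show ?thesis
    using pt_in_range [OF assms, of a] int_pt [OF assms, of a]
    by (simp add: dihedral_map_def pt_def)
qed

lemma dihedral_map_comp:
  assumes "0 < n"
  shows "dihedral_map n s c \<circ> dihedral_map n t d = dihedral_map n (s * t) (s * d + c)"
proof
  fix p
  show "(dihedral_map n s c \<circ> dihedral_map n t d) p = dihedral_map n (s * t) (s * d + c) p"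
  proof (cases "p \<in> {1..n}")
    case True
    then obtain a where "p = pt n a" using ex_pt by blast
    then show ?thesis by (simp add: dihedral_map_pt [OF assms] algebra_simps)
  next
    case False
    then show ?thesis by (simp only: not_False_eq_True dihedral_map_outside o_apply)
  qed
qed

lemma dihedral_map_id: "dihedral_map n 1 0 = id"
  by (rule ext) (use pt_of_point in \<open>force simp: dihedral_map_def\<close>)

lemma rot_perm_eq: "0 < n \<Longrightarrow> rot_perm n = dihedral_map n 1 1"
proof
  fix p assume "0 < n"
  show "rot_perm n p = dihedral_map n 1 1 p"
  proof (cases "p \<in> {1..n}")
    case True
    then obtain a where "p = pt n a" using ex_pt by blast
    then show ?thesis using \<open>0 < n\<close> by (simp add: rot_perm_pt dihedral_map_pt)
  qed (simp only: not_False_eq_True dihedral_map_outside rot_perm_def if_False)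
qed

lemma refl_perm_eq: "0 < n \<Longrightarrow> refl_perm n = dihedral_map n (- 1) (- 1)"
proof
  fix p assume "0 < n"
  show "refl_perm n p = dihedral_map n (- 1) (- 1) p"
  proof (cases "p \<in> {1..n}")
    case True
    then have "(- int p) mod int n = int n - int p"
      using \<open>0 < n\<close> by (cases "p = n") (auto simp: zmod_zminus1_eq_if mod_pos_pos_trivial)
    then show ?thesis
      using True by (auto simp: refl_perm_def dihedral_map_def pt_def of_nat_diff)
  qed (simp only: not_False_eq_True dihedral_map_outside refl_perm_def if_False)
qed

lemma dihedral_map_permutes:
  assumes "0 < n" "s = 1 \<or> s = - 1"
  shows "dihedral_map n s c permutes {1..n}"
proof (rule bij_imp_permutes)
  have s: "s * s = 1" using assms(2) by auto
  \<comment> \<open>For s = 1 or s = -1 the inverse of a -> s a + c is a -> s a - s c.\<close>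
  have "dihedral_map n s c \<circ> dihedral_map n s (- s * c) = id"
    "dihedral_map n s (- s * c) \<circ> dihedral_map n s c = id"
    unfolding dihedral_map_comp [OF assms(1)]
    by (simp_all add: s dihedral_map_id flip: mult.assoc)
  then have "bij (dihedral_map n s c)" by (rule o_bij [rotated])
  moreover have "dihedral_map n s c ` {1..n} \<subseteq> {1..n}"
    using pt_in_range [OF assms(1)] by (force simp: dihedral_map_def)
  ultimately show "bij_betw (dihedral_map n s c) {1..n} {1..n}"
    by (metis bij_def bij_betw_def endo_inj_surj finite_atLeastAtMost inj_on_subset subset_UNIV)
qed (rule dihedral_map_outside)

lemma dihedral_perms_eq:
  assumes "0 < n"
  shows "dihedral_perms n = {dihedral_map n s c | s c. s = 1 \<or> s = - 1}" (is "_ = ?D")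
proof
  interpret group "sym_group n" by (rule sym_group_is_group)
  show "dihedral_perms n \<subseteq> ?D"
  proof
    fix \<sigma> assume "\<sigma> \<in> dihedral_perms n"
    then have "\<sigma> \<in> generate (sym_group n) {rot_perm n, refl_perm n}" by (simp add: dihedral_perms_def)
    then show "\<sigma> \<in> ?D"
    proof induction
      case one
      show ?case unfolding sym_group_one dihedral_map_id [of n, symmetric] by blast
    next
      case (incl h)
      then show ?case using rot_perm_eq refl_perm_eq assms by auto
    next
      case (inv h)
      then have "h = dihedral_map n 1 1 \<or> h = dihedral_map n (- 1) (- 1)"
        using rot_perm_eq refl_perm_eq assms by auto
      \<comment> \<open>In both generators the shift equals the multiplier, so a -> s a - 1 inverts
        a -> s a + s in either case.\<close>
      then obtain s where s: "s = 1 \<or> s = - 1" "h = dihedral_map n s s" by auto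
      have "s * s = 1" using s(1) by auto
      then have "dihedral_map n s (- 1) \<circ> h = id"
        by (simp add: s(2) dihedral_map_comp [OF assms] dihedral_map_id)
      then have "inv\<^bsub>sym_group n\<^esub> h = dihedral_map n s (- 1)"
        using dihedral_map_permutes [OF assms s(1)] s(2)
        by (intro inv_equality) (auto simp: sym_group_def)
      then show ?case using s by auto
    next
      case (eng h1 h2)
      then obtain s c t d where "s = 1 \<or> s = - 1" "t = 1 \<or> t = - 1"
        "h1 = dihedral_map n s c" "h2 = dihedral_map n t d" by blast
      moreover from this have "h1 \<otimes>\<^bsub>sym_group n\<^esub> h2 = dihedral_map n (s * t) (s * d + c)"
        by (simp add: sym_group_mult dihedral_map_comp [OF assms])
      ultimately show ?case by auto
    qed
  qed
  show "?D \<subseteq> dihedral_perms n"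
  proof
    have gens: "rot_perm n \<in> dihedral_perms n" "refl_perm n \<in> dihedral_perms n"
      by (simp_all add: dihedral_perms_def generate.incl)
    have comp: "\<sigma> \<circ> \<tau> \<in> dihedral_perms n" if "\<sigma> \<in> dihedral_perms n" "\<tau> \<in> dihedral_perms n" for \<sigma> \<tau>
      using that generate.eng [of \<sigma> "sym_group n" _ \<tau>]
      unfolding dihedral_perms_def sym_group_mult by blast
    have rot: "dihedral_map n 1 (int k) \<in> dihedral_perms n" for k
    proof (induction k)
      case 0
      show ?case
        using generate.one [of "sym_group n"]
        by (simp only: dihedral_perms_def of_nat_0 dihedral_map_id sym_group_one)
    next
      case (Suc k)
      have "dihedral_map n 1 (int (Suc k)) = rot_perm n \<circ> dihedral_map n 1 (int k)"
        by (simp add: rot_perm_eq [OF assms] dihedral_map_comp [OF assms] add.commute)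
      then show ?case
        using comp [OF gens(1) Suc] by (simp only:)
    qed
    have rot': "dihedral_map n 1 c \<in> dihedral_perms n" for c
    proof -
      have "dihedral_map n 1 c = dihedral_map n 1 (int (nat (c mod int n)))"
        using assms by (intro ext) (simp add: dihedral_map_def pt_eq_iff mod_eq_dvd_iff [symmetric] mod_simps)
      then show ?thesis using rot [of "nat (c mod int n)"] by (simp only:)
    qed
    fix \<sigma> assume "\<sigma> \<in> ?D"
    then obtain s c where \<sigma>: "\<sigma> = dihedral_map n s c" "s = 1 \<or> s = - 1" by blast
    from \<sigma>(2) show "\<sigma> \<in> dihedral_perms n"
    proof
      assume "s = - 1"
      \<comment> \<open>The generator h is a -> -a - 1, so a further rotation by c + 1 yields a ->
        -a + c.\<close>
      then have "\<sigma> = dihedral_map n 1 (c + 1) \<circ> refl_perm n"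
        by (simp add: \<sigma>(1) refl_perm_eq [OF assms] dihedral_map_comp [OF assms])
      then show ?thesis
        using comp [OF rot' [of "c + 1"] gens(2)] by (simp only:)
    qed (use rot' \<sigma> in simp)
  qed
qed

section \<open>Descents of restricted rotations and reflections\<close>

lemma carrier_OPDI:
  "carrier (OPDI n) =
     {(Some \<circ> \<sigma>) |` A | \<sigma> A. \<sigma> \<in> dihedral_perms n \<and> A \<subseteq> {1..n} \<and>
        orientation_preserving ((Some \<circ> \<sigma>) |` A)}"
  by (auto simp: OPDI_def dihedral_inv_monoid_def)

lemma mult_OPDI: "\<alpha> \<otimes>\<^bsub>OPDI n\<^esub> \<beta> = \<beta> \<circ>\<^sub>m \<alpha>"
  by (simp add: OPDI_def dihedral_inv_monoid_def sym_inv_monoid_def)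

lemma orientation_preserving_restrict:
  "finite A \<Longrightarrow> orientation_preserving ((Some \<circ> \<sigma>) |` A) \<longleftrightarrow>
     cyclic_seq (map \<sigma> (sorted_list_of_set A))"
proof -
  assume "finite A"
  then have "map (\<lambda>a. the (((Some \<circ> \<sigma>) |` A) a)) (sorted_list_of_set A) = map \<sigma> (sorted_list_of_set A)"
    using \<open>finite A\<close> by (intro map_cong) auto
  moreover have "dom ((Some \<circ> \<sigma>) |` A) = A" by (auto simp: restrict_map_def split: if_splits)
  ultimately show ?thesis by (simp only: orientation_preserving_def)
qed

text \<open>Two descents in a sequence of length two would compare the same two entries in opposite
  directions. Hence every restricted reflection of rank at most two preserves orientation.\<close>

lemma cyclic_seq_short:
  assumes "length bs \<le> 2"
  shows "cyclic_seq bs"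
proof -
  let ?D = "{i. i < length bs \<and> bs ! i > bs ! (Suc i mod length bs)}"
  have "i = j" if "i \<in> ?D" "j \<in> ?D" for i j
  proof (rule ccontr)
    assume "i \<noteq> j"
    then have "length bs = 2" "{i, j} = {0, 1}" using that assms by auto
    then have "bs ! 0 > bs ! 1" "bs ! 1 > bs ! 0"
      using that by (auto simp: doubleton_eq_iff)
    then show False by simp
  qed
  then have "card ?D \<le> 1" by (intro card_le_Suc0_iff_eq [THEN iffD2, folded One_nat_def]) auto
  then show ?thesis by (simp add: cyclic_seq_def)
qed

text \<open>In a sorted list, read cyclically, at most one step crosses the threshold \<open>T\<close> in a prescribed
  direction: upwards inside the list, or else at the closing step from the last entry to the first.\<close>

lemma card_threshold_le_1:
  fixes as :: "nat list"
  assumes "sorted as" "D \<subseteq> {..<length as}"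
    and inner: "\<And>i. i \<in> D \<Longrightarrow> Suc i < length as \<Longrightarrow> as ! i < T \<and> T \<le> as ! Suc i"
    and last: "\<And>i. i \<in> D \<Longrightarrow> Suc i = length as \<Longrightarrow> \<not> (as ! 0 < T \<and> T \<le> as ! i)"
  shows "card D \<le> 1"
proof -
  \<comment> \<open>If \<open>i\<close> precedes \<open>j\<close> in \<open>D\<close>, the crossing
    at \<open>i\<close> forces \<open>as ! 0 < T \<le> as ! j\<close>. This excludes both a crossing
    at \<open>j\<close> inside the list and membership of \<open>j\<close> as the closing
    step.\<close>
  have less: False if D: "i \<in> D" "j \<in> D" and ij: "i < j" for i j
  proof -
    have j: "j < length as" using D assms(2) by auto
    then have i: "as ! i < T" "T \<le> as ! Suc i" using inner [OF D(1)] ij by auto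
    have "as ! Suc i \<le> as ! j" "as ! 0 \<le> as ! i"
      using assms(1) ij j by (auto intro: sorted_nth_mono)
    then show False
      using i inner [OF D(2)] last [OF D(2)] j by (cases "Suc j = length as") auto
  qed
  have "i = j" if "i \<in> D" "j \<in> D" for i j
    using less that by (metis linorder_neqE_nat)
  moreover have "finite D" using assms(2) finite_subset by blast
  ultimately show ?thesis by (simp add: card_le_Suc0_iff_eq One_nat_def)
qed

text \<open>For a shift in the range from 0 to n - 1 at most one wrap occurs, which leaves only
  linear arithmetic. The first wrapping points, n - c + 1 for rotations and c + 2 for reflections,
  serve as thresholds below.\<close>

lemma dihedral_map_cases:
  assumes "p \<in> {1..n}" "0 \<le> c" "c < int n"
  shows "int (dihedral_map n 1 c p) = (if int p + c \<le> int n then int p + c else int p + c - int n)"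
    and "int (dihedral_map n (- 1) c p) = (if int p \<le> c + 1 then c + 2 - int p else c + 2 - int p + int n)"
proof -
  have n: "0 < n" using assms by auto
  have "(int p - 1 + c) mod int n = (if int p + c \<le> int n then int p - 1 + c else int p - 1 + c - int n)"
  proof (cases "int p + c \<le> int n")
    case False
    have "(int p - 1 + c) mod int n = (int p - 1 + c - int n) mod int n" by simp
    also have "\<dots> = int p - 1 + c - int n" using assms False by (intro mod_pos_pos_trivial) auto
    finally show ?thesis using False by simp
  qed (use assms in \<open>auto simp: mod_pos_pos_trivial\<close>)
  then show "int (dihedral_map n 1 c p) = (if int p + c \<le> int n then int p + c else int p + c - int n)"
    using assms(1) int_pt [OF n] by (simp add: dihedral_map_def)
  have "(1 - int p + c) mod int n = (if int p \<le> c + 1 then 1 - int p + c else 1 - int p + c + int n)"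
  proof (cases "int p \<le> c + 1")
    case False
    have "(1 - int p + c) mod int n = (1 - int p + c + int n) mod int n" by simp
    also have "\<dots> = 1 - int p + c + int n" using assms False by (intro mod_pos_pos_trivial) auto
    finally show ?thesis using False by simp
  qed (use assms in \<open>auto simp: mod_pos_pos_trivial\<close>)
  then show "int (dihedral_map n (- 1) c p) = (if int p \<le> c + 1 then c + 2 - int p else c + 2 - int p + int n)"
    using assms(1) int_pt [OF n] by (simp add: dihedral_map_def algebra_simps)
qed

lemma dihedral_map_mod:
  assumes "0 < n"
  shows "dihedral_map n s (c mod int n) = dihedral_map n s c"
  using assms by (intro ext) (simp add: dihedral_map_def pt_eq_iff mod_eq_dvd_iff [symmetric] mod_simps)

text \<open>A rotation increases on each side of its threshold and drops when a step crosses it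
  upwards. When the first entry does not wrap and the last one does, the closing step is no
  descent.\<close>

lemma cyclic_seq_rotation:
  assumes "0 < n" "A \<subseteq> {1..n}"
  shows "cyclic_seq (map (dihedral_map n 1 c) (sorted_list_of_set A))"
proof -
  define d where "d = c mod int n"
  have d: "0 \<le> d" "d < int n" using assms by (simp_all add: d_def)
  define as where "as = sorted_list_of_set A"
  have fin: "finite A" using assms(2) finite_subset by blast
  have range: "as ! i \<in> {1..n}" if "i < length as" for i
    using that nth_mem [of i as] fin assms(2) by (auto simp: as_def)
  let ?v = "dihedral_map n 1 d"
  note v = dihedral_map_cases(1) [OF range d]
  let ?D = "{i. i < length (map ?v as) \<and> map ?v as ! i > map ?v as ! (Suc i mod length (map ?v as))}"
  have mono: "as ! i \<le> as ! j" if "i \<le> j" "j < length as" for i j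
    using that by (simp add: as_def sorted_nth_mono)
  have "card ?D \<le> 1"
  proof (rule card_threshold_le_1 [of as _ "nat (int n - d + 1)"])
    fix i assume i: "i \<in> ?D"
    show "as ! i < nat (int n - d + 1) \<and> nat (int n - d + 1) \<le> as ! Suc i" if l: "Suc i < length as"
    proof -
      have "?v (as ! Suc i) < ?v (as ! i)" using i l by simp
      then show ?thesis
        using v [of i] v [of "Suc i"] mono [of i "Suc i"] l range [of "Suc i"] d by (auto split: if_splits)
    qed
    show "\<not> (as ! 0 < nat (int n - d + 1) \<and> nat (int n - d + 1) \<le> as ! i)" if l: "Suc i = length as"
    proof -
      have closing: "Suc i mod length as = 0" "0 < length as" unfolding l [symmetric] by simp_all
      then have "?v (as ! 0) < ?v (as ! i)" using i by auto
      then show ?thesis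
        using v [of i] v [OF closing(2)] l range [of i] range [OF closing(2)] d
        by (auto split: if_splits)
    qed
  qed (auto simp: as_def)
  then show ?thesis
    by (simp add: cyclic_seq_def d_def as_def dihedral_map_mod [OF assms(1)])
qed

text \<open>A reflection decreases on each side of its threshold, so the steps that are not descents
  are the ones to bound. At most one exists, hence at least two of the three or more cyclic steps
  descend.\<close>

lemma not_cyclic_seq_reflection:
  assumes "0 < n" "A \<subseteq> {1..n}" "3 \<le> card A"
  shows "\<not> cyclic_seq (map (dihedral_map n (- 1) c) (sorted_list_of_set A))"
proof -
  define d where "d = c mod int n"
  have d: "0 \<le> d" "d < int n" using assms by (simp_all add: d_def)
  define as where "as = sorted_list_of_set A"
  have fin: "finite A" using assms(2) finite_subset by blast
  have range: "as ! i \<in> {1..n}" if "i < length as" for i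
    using that nth_mem [of i as] fin assms(2) by (auto simp: as_def)
  let ?v = "dihedral_map n (- 1) d"
  note v = dihedral_map_cases(2) [OF range d]
  let ?P = "\<lambda>i. map ?v as ! i > map ?v as ! (Suc i mod length (map ?v as))"
  have mono: "as ! i < as ! j" if "i < j" "j < length as" for i j
    using that fin strict_sorted_list_of_set [of A]
    by (auto simp: as_def sorted_wrt_nth_less)
  have len: "3 \<le> length as" using assms(3) by (simp add: as_def)
  have "card {i. i < length as \<and> \<not> ?P i} \<le> 1"
  proof (rule card_threshold_le_1 [of as _ "nat (d + 2)"])
    fix i assume i: "i \<in> {i. i < length as \<and> \<not> ?P i}"
    show "as ! i < nat (d + 2) \<and> nat (d + 2) \<le> as ! Suc i" if l: "Suc i < length as"
    proof -
      have "\<not> ?v (as ! Suc i) < ?v (as ! i)" using i l by simp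
      then show ?thesis
        using v [of i] v [of "Suc i"] mono [of i "Suc i"] l range [of "Suc i"] range [of i] d
        by (auto split: if_splits)
    qed
    show "\<not> (as ! 0 < nat (d + 2) \<and> nat (d + 2) \<le> as ! i)" if l: "Suc i = length as"
    proof -
      have closing: "Suc i mod length as = 0" "0 < length as" unfolding l [symmetric] by simp_all
      then have "\<not> ?v (as ! 0) < ?v (as ! i)" using i by auto
      then show ?thesis
        using v [of i] v [OF closing(2)] l range [of i] range [OF closing(2)] d
        by (auto split: if_splits)
    qed
  qed (auto simp: as_def)
  moreover have "{i. i < length as \<and> ?P i} = {..<length as} - {i. i < length as \<and> \<not> ?P i}"
    by blast
  then have "card {i. i < length as \<and> ?P i} = length as - card {i. i < length as \<and> \<not> ?P i}"
    by (simp only: card_lessThan) (subst card_Diff_subset; force)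
  ultimately have "2 \<le> card {i. i < length as \<and> ?P i}" using len by linarith
  then show ?thesis
    by (simp add: cyclic_seq_def d_def as_def dihedral_map_mod [OF assms(1)])
qed

section \<open>The isomorphism\<close>

context point_model
begin

abbreviation val :: "letter list \<Rightarrow> nat option endo" where
  "val \<equiv> word_val (point_action n)"

lemma proper_val: "w \<in> lists (alphabet m) \<Longrightarrow> proper n (val w)"
  by (rule proper_word_val [OF n_pos _ two_m_less])

lemma act_rotational:
  "apply_endo (S.P xs * S.G k) (Some (pt n z)) =
     (if \<exists>b\<in>set xs. int n dvd z - b then None else Some (pt n (z + k)))"
  by simp

lemma act_reflection:
  "i \<in> {1..m} \<Longrightarrow> apply_endo (S.G a * S.x i * S.G b) (Some (pt n z)) =
     (if int n dvd z + a then Some (pt n b)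
      else if int n dvd z + a - int i then Some (pt n (b - int i)) else None)"
  by simp

lemma normal_words_cases:
  assumes "v \<in> normal_words n m"
  obtains (rot) xs k where "v = idempotent_word n xs @ rotation_word n k"
    | (refl) a i b where "i \<in> {1..m}" "v = rotation_word n a @ xw i @ rotation_word n b"
  using assms unfolding normal_words_def by blast

lemma partial_map_eq_restrict:
  assumes "\<And>z. apply_endo c (Some (pt n z)) = (if pt n z \<in> A then Some (\<sigma> (pt n z)) else None)"
    and "A \<subseteq> {1..n}"
  shows "partial_map n c = (Some \<circ> \<sigma>) |` A"
proof
  fix p
  show "partial_map n c p = ((Some \<circ> \<sigma>) |` A) p"
  proof (cases "p \<in> {1..n}")
    case True
    then obtain z where "p = pt n z" using ex_pt by blast
    then show ?thesis using True assms(1) [of z] by (simp add: partial_map_def restrict_map_def)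
  next
    case False
    then have "p \<notin> A" using assms(2) by blast
    then show ?thesis using False by (simp only: partial_map_def restrict_map_def if_False)
  qed
qed

lemma partial_map_in_carrier_OPDI:
  assumes "s = 1 \<or> s = - 1"
    and "\<And>z. apply_endo c (Some (pt n z)) \<in> {None, Some (pt n (s * z + k))}"
    and "s = 1 \<or> card (dom (partial_map n c)) \<le> 2"
  shows "partial_map n c \<in> carrier (OPDI n)"
proof -
  define A where "A = dom (partial_map n c)"
  define \<sigma> where "\<sigma> = dihedral_map n s k"
  have A: "A \<subseteq> {1..n}" by (auto simp: A_def partial_map_def split: if_splits)
  have eq: "partial_map n c = (Some \<circ> \<sigma>) |` A"
  proof (rule partial_map_eq_restrict [OF _ A])
    fix z
    show "apply_endo c (Some (pt n z)) = (if pt n z \<in> A then Some (\<sigma> (pt n z)) else None)"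
      using assms(2) [of z] pt_in_range [OF n_pos, of z]
      by (auto simp: A_def \<sigma>_def dihedral_map_pt [OF n_pos] dom_def partial_map_def)
  qed
  have "cyclic_seq (map \<sigma> (sorted_list_of_set A))"
    using assms(3)
  proof
    assume "s = 1"
    then show ?thesis unfolding \<sigma>_def using cyclic_seq_rotation [OF n_pos A] by simp
  next
    assume "card (dom (partial_map n c)) \<le> 2"
    then show ?thesis by (intro cyclic_seq_short) (simp add: A_def)
  qed
  then have "orientation_preserving ((Some \<circ> \<sigma>) |` A)"
    using A finite_subset by (subst orientation_preserving_restrict) blast+
  moreover have "\<sigma> \<in> dihedral_perms n"
    unfolding dihedral_perms_eq [OF n_pos] \<sigma>_def using assms(1) by blast
  ultimately show ?thesis
    unfolding carrier_OPDI eq using A by blast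
qed

lemma normal_word_in_carrier_OPDI:
  assumes "v \<in> normal_words n m"
  shows "partial_map n (val v) \<in> carrier (OPDI n)"
  using assms
proof (cases rule: normal_words_cases)
  case (rot xs k)
  then have "apply_endo (val v) (Some (pt n z)) \<in> {None, Some (pt n (1 * z + k))}" for z
    by simp
  then show ?thesis using partial_map_in_carrier_OPDI by blast
next
  case (refl a i b)
  then have val: "val v = S.G a * S.x i * S.G b" by (simp add: mult.assoc)
  \<comment> \<open>The word acts as z -> -z + (b - a): at its two domain residues -a and i - a this
    gives b and b - i.\<close>
  have "apply_endo (val v) (Some (pt n z)) \<in> {None, Some (pt n (- 1 * z + (b - a)))}" for z
  proof -
    have "b - (- 1 * z + (b - a)) = z + a" "b - int i - (- 1 * z + (b - a)) = z + a - int i"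
      by simp_all
    then have "int n dvd z + a \<Longrightarrow> pt n b = pt n (- 1 * z + (b - a))"
      "int n dvd z + a - int i \<Longrightarrow> pt n (b - int i) = pt n (- 1 * z + (b - a))"
      using pt_eq_iff [OF n_pos] by metis+
    then show ?thesis
      unfolding val act_reflection [OF refl(1)] by auto
  qed
  moreover have "card (dom (partial_map n (val v))) \<le> 2"
  proof -
    have "dom (partial_map n (val v)) \<subseteq> {pt n (- a), pt n (int i - a)}"
    proof
      fix p assume p: "p \<in> dom (partial_map n (val v))"
      then have "p \<in> {1..n}" by (auto simp: partial_map_def split: if_splits)
      then obtain z where z: "p = pt n z" using ex_pt by blast
      have "apply_endo (S.G a * S.x i * S.G b) (Some (pt n z)) \<noteq> None"
        using p \<open>p \<in> {1..n}\<close> by (simp only: partial_map_def val z dom_def mem_Collect_eq if_True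
            not_False_eq_True)
      then have "int n dvd z + a \<or> int n dvd z + a - int i"
        unfolding act_reflection [OF refl(1)] by metis
      moreover have "z - - a = z + a" "z - (int i - a) = z + a - int i" by simp_all
      ultimately have "int n dvd z - - a \<or> int n dvd z - (int i - a)"
        by (simp only:)
      then show "p \<in> {pt n (- a), pt n (int i - a)}"
        unfolding z using pt_eq_iff [OF n_pos] by blast
    qed
    then have "card (dom (partial_map n (val v))) \<le> card {pt n (- a), pt n (int i - a)}"
      by (intro card_mono) auto
    also have "\<dots> \<le> 2" by (simp add: card_insert_if)
    finally show ?thesis .
  qed
  ultimately show ?thesis using partial_map_in_carrier_OPDI by blast
qed

text \<open>Delete the residues of the points outside \<open>A\<close>, then rotate. Agreement of
  \<sigma> with a rotation is required on \<open>A\<close> only, so that restricted reflections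
  which happen to be restricted rotations are covered too.\<close>

lemma ex_normal_word_rotation:
  assumes "A \<subseteq> {1..n}" and "\<And>z. pt n z \<in> A \<Longrightarrow> \<sigma> (pt n z) = pt n (z + k)"
  shows "\<exists>v\<in>normal_words n m. partial_map n (val v) = (Some \<circ> \<sigma>) |` A"
proof
  define xs where "xs = map (\<lambda>p. int p - 1) (filter (\<lambda>p. p \<notin> A) [1..<Suc n])"
  have "(\<exists>b\<in>set xs. int n dvd z - b) \<longleftrightarrow> pt n z \<notin> A" for z
  proof
    assume "\<exists>b\<in>set xs. int n dvd z - b"
    then obtain p where p: "p \<in> {1..n}" "p \<notin> A" "int n dvd z - (int p - 1)"
      by (auto simp: xs_def less_Suc_eq_le)
    then have "pt n z = p" using pt_eq_iff [OF n_pos] pt_of_point by metis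
    then show "pt n z \<notin> A" using p by simp
  next
    assume "pt n z \<notin> A"
    then have "int (pt n z) - 1 \<in> set xs" using pt_in_range [OF n_pos, of z] by (auto simp: xs_def)
    moreover have "int n dvd z - (int (pt n z) - 1)"
      using pt_eq_iff [OF n_pos] pt_of_point [OF pt_in_range [OF n_pos]] by metis
    ultimately show "\<exists>b\<in>set xs. int n dvd z - b" by blast
  qed
  then show "partial_map n (val (idempotent_word n xs @ rotation_word n k)) = (Some \<circ> \<sigma>) |` A"
    using assms by (intro partial_map_eq_restrict) auto
  show "idempotent_word n xs @ rotation_word n k \<in> normal_words n m"
    unfolding normal_words_def by blast
qed

lemma ex_normal_word_reflection:
  assumes i: "i \<in> {1..m}" and d: "int n dvd b - a - int i"
  shows "\<exists>v\<in>normal_words n m.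
    partial_map n (val v) = (Some \<circ> dihedral_map n (- 1) c) |` {pt n a, pt n b}"
proof
  \<comment> \<open>Translate a to 0 and b to i, reflect by x_i, then translate by c - a; the
    results are c - a and c - b.\<close>
  let ?v = "rotation_word n (- a) @ xw i @ rotation_word n (c - a)"
  show "?v \<in> normal_words n m" unfolding normal_words_def using i by blast
  have val: "val ?v = S.G (- a) * S.x i * S.G (c - a)" by (simp add: mult.assoc)
  show "partial_map n (val ?v) = (Some \<circ> dihedral_map n (- 1) c) |` {pt n a, pt n b}"
  proof (rule partial_map_eq_restrict)
    fix z
    have b: "int n dvd z + - a - int i \<longleftrightarrow> int n dvd z - b"
      using dvd_add_right_iff [OF d, of "z - b"] by (simp add: algebra_simps)
    have "(c - a) - (- 1 * z + c) = z + - a" "(c - a - int i) - (- 1 * z + c) = z + - a - int i"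
      by simp_all
    then have "int n dvd z + - a \<Longrightarrow> pt n (c - a) = pt n (- 1 * z + c)"
      "int n dvd z + - a - int i \<Longrightarrow> pt n (c - a - int i) = pt n (- 1 * z + c)"
      using pt_eq_iff [OF n_pos] by metis+
    then show "apply_endo (val ?v) (Some (pt n z)) =
        (if pt n z \<in> {pt n a, pt n b} then Some (dihedral_map n (- 1) c (pt n z)) else None)"
      unfolding val act_reflection [OF i] b dihedral_map_pt [OF n_pos]
      using pt_eq_iff [OF n_pos] by auto
  qed (use pt_in_range [OF n_pos] in blast)
qed

text \<open>Equal or antipodal points fall under rotations. Otherwise one of b - a and a - b has
  residue in {1..m}, and the points are exchanged if it is the latter. The case of equal points
  covers singletons.\<close>

lemma ex_normal_word_of_pair:
  "\<exists>v\<in>normal_words n m.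
     partial_map n (val v) = (Some \<circ> dihedral_map n (- 1) c) |` {pt n a, pt n b}"
proof (cases "int n dvd 2 * (b - a)")
  case True
  show ?thesis
  \<comment> \<open>The rotation is forced by its value at a, since -a + c = a + (c - 2 a); at b the
    two maps differ by 2 (b - a), which n divides.\<close>
  proof (rule ex_normal_word_rotation [of _ _ "c - 2 * a"])
    show "{pt n a, pt n b} \<subseteq> {1..n}" using pt_in_range [OF n_pos] by blast
    fix z assume "pt n z \<in> {pt n a, pt n b}"
    then have "int n dvd z - a \<or> int n dvd z - b" using pt_eq_iff [OF n_pos] by auto
    then have "int n dvd 2 * (z - a)"
    proof
      assume "int n dvd z - b"
      then have "int n dvd 2 * (z - b) + 2 * (b - a)" using True by (intro dvd_add [OF dvd_mult])
      moreover have "2 * (z - b) + 2 * (b - a) = 2 * (z - a)" by simp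
      ultimately show ?thesis by (simp only:)
    qed (rule dvd_mult)
    moreover have "z + (c - 2 * a) - (- 1 * z + c) = 2 * (z - a)" by simp
    ultimately show "dihedral_map n (- 1) c (pt n z) = pt n (z + (c - 2 * a))"
      unfolding dihedral_map_pt [OF n_pos] using pt_eq_iff [OF n_pos] by metis
  qed
next
  case False
  define d where "d = (b - a) mod int n"
  have d: "0 \<le> d" "d < int n" using n_pos by (simp_all add: d_def)
  have dvd: "int n dvd b - a - d" by (simp add: d_def mod_eq_dvd_iff [symmetric])
  have neq: "d \<noteq> 0" "2 * d \<noteq> int n"
  proof -
    have "int n dvd 2 * (b - a - d)" using dvd by (rule dvd_mult)
    then have "\<not> int n dvd 2 * d" using False dvd_add [of "int n" "2 * (b - a - d)" "2 * d"] by auto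
    then show "d \<noteq> 0" "2 * d \<noteq> int n" by auto
  qed
  show ?thesis
  proof (cases "2 * d < int n")
    case True
    then have "nat d \<in> {1..m}" using d neq m_eq by auto
    then show ?thesis using ex_normal_word_reflection [of "nat d" b a] dvd d by simp
  next
    case False
    then have "nat (int n - d) \<in> {1..m}" using d neq m_eq by auto
    moreover have "a - b - (int n - d) = - (b - a - d) - int n" by simp
    then have "int n dvd a - b - (int n - d)"
      using dvd by (metis dvd_diff dvd_minus_iff dvd_refl)
    ultimately show ?thesis
      using ex_normal_word_reflection [of "nat (int n - d)" a b] d by (simp add: insert_commute)
  qed
qed

lemma carrier_OPDI_subset:
  assumes "\<alpha> \<in> carrier (OPDI n)"
  shows "\<exists>v\<in>normal_words n m. partial_map n (val v) = \<alpha>"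
proof -
  obtain s c A where \<alpha>: "\<alpha> = (Some \<circ> dihedral_map n s c) |` A" "s = 1 \<or> s = - 1" "A \<subseteq> {1..n}"
    "orientation_preserving \<alpha>"
    using assms unfolding carrier_OPDI dihedral_perms_eq [OF n_pos] by blast
  have fin: "finite A" using \<alpha>(3) finite_subset by blast
  from \<alpha>(2) show ?thesis
  proof
    assume "s = 1"
    then show ?thesis
      unfolding \<alpha>(1) by (intro ex_normal_word_rotation [OF \<alpha>(3), of _ c]) (simp add: dihedral_map_pt [OF n_pos])
  next
    assume s: "s = - 1"
    have "\<not> 3 \<le> card A"
      using not_cyclic_seq_reflection [OF n_pos \<alpha>(3), of c] \<alpha>(4)
      unfolding \<alpha>(1) s orientation_preserving_restrict [OF fin] by blast
    then consider "card A = 0" | "card A = 1" | "card A = 2" by linarith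
    \<comment> \<open>A singleton appears here as a pair with \<open>p = q\<close>.\<close>
    then consider "A = {}" | p q where "A = {p, q}"
      using fin by cases (auto simp: card_1_singleton_iff One_nat_def card_2_iff)
    then show ?thesis
    proof cases
      case 1
      then show ?thesis unfolding \<alpha>(1) by (intro ex_normal_word_rotation [of _ _ 0]) auto
    next
      case 2
      then obtain a b where "A = {pt n a, pt n b}" using \<alpha>(3) ex_pt by (metis insert_subset)
      then show ?thesis unfolding \<alpha>(1) s using ex_normal_word_of_pair by blast
    qed
  qed
qed

text \<open>The partial map determines the parameters of a normal form as far as its value depends
  on them: the domain gives the idempotent part, respectively a and i modulo n, and one image gives
  the final rotation. Only the empty map leaves the rotation open, and there it is absorbed.\<close>

lemma word_val_eq_if_val_eq:
  fixes f :: "letter \<Rightarrow> 'a::monoid_mult"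
  assumes T: "relation_model n f m" and v: "v \<in> normal_words n m" "w \<in> normal_words n m"
    and eq: "val v = val w"
  shows "word_val f v = word_val f w"
proof -
  interpret T: relation_model n f m by (rule T)
  have nd: "\<not> int n dvd z" if "z \<noteq> 0" "\<bar>z\<bar> < int n" for z
    using S.dvd_imp_zero that by blast
  \<comment> \<open>A rotation displaces all points equally, whereas
    \<open>S.G a * S.x i * S.G b\<close> displaces its two points by amounts that differ by 2
    i.\<close>
  have rot_refl: False
    if val: "S.P xs * S.G k = S.G a * S.x i * S.G b" and i: "i \<in> {1..m}" for xs k a i b
  proof -
    have act: "apply_endo (S.P xs * S.G k) (Some (pt n z)) =
        (if int n dvd z + a then Some (pt n b)
         else if int n dvd z + a - int i then Some (pt n (b - int i)) else None)" for z
      unfolding val act_reflection [OF i] ..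
    have "pt n (- a + k) = pt n b"
      using act [of "- a"] by (simp split: if_splits)
    then have "int n dvd - a + k - b" by (simp only: pt_eq_iff [OF n_pos])
    moreover have "pt n (int i - a + k) = pt n (b - int i)"
      using act [of "int i - a"] not_dvd [OF i] by (simp split: if_splits)
    then have "int n dvd int i - a + k - (b - int i)" by (simp only: pt_eq_iff [OF n_pos])
    ultimately have "int n dvd (int i - a + k - (b - int i)) - (- a + k - b)"
      using dvd_diff by blast
    then show False using not_dvd(2) [OF i] by simp
  qed
  from v(1) show ?thesis
  proof (cases rule: normal_words_cases)
    case v: (rot xs k)
    from \<open>w \<in> normal_words n m\<close> show ?thesis
    proof (cases rule: normal_words_cases)
      case w: (rot ys l)
      have act: "(if \<exists>b\<in>set xs. int n dvd z - b then None else Some (pt n (z + k))) =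
        (if \<exists>b\<in>set ys. int n dvd z - b then None else Some (pt n (z + l)))" for z
        using eq unfolding v w by (metis act_rotational S.word_val_idempotent_word
            S.word_val_rotation_word word_val_simps(3))
      then have iff: "(\<exists>b\<in>set xs. int n dvd z - b) \<longleftrightarrow> (\<exists>b\<in>set ys. int n dvd z - b)" for z
        by (metis option.distinct(1))
      then have "T.P xs = T.P ys" by (rule T.P_cong)
      moreover have "T.P xs * T.G k = T.P xs * T.G l"
      proof (cases "\<forall>z. \<exists>b\<in>set xs. int n dvd z - b")
        case True
        \<comment> \<open>This is the empty map: \<open>k\<close> and \<open>l\<close> may differ,
          but both sides are the zero \<open>T.K {}\<close>.\<close>
        then show ?thesis by (simp add: T.P_eq_zero)
      next
        case False
        then obtain z where "\<not> (\<exists>b\<in>set xs. int n dvd z - b)" by blast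
        then have "pt n (z + k) = pt n (z + l)" using act [of z] iff [of z] by simp
        then have "int n dvd k - l" by (simp add: pt_eq_iff [OF n_pos])
        then have "T.G k = T.G l" by (rule T.G_cong)
        then show ?thesis by simp
      qed
      ultimately show ?thesis by (simp add: v w)
    next
      case w: (refl a i b)
      then show ?thesis using rot_refl [of xs k a i b] eq by (simp add: v mult.assoc)
    qed
  next
    case v: (refl a i b)
    from \<open>w \<in> normal_words n m\<close> show ?thesis
    proof (cases rule: normal_words_cases)
      case w: (rot xs k)
      then show ?thesis using rot_refl [of xs k a i b] eq v by (simp add: mult.assoc)
    next
      case w: (refl a' j b')
      have "S.G a * S.x i * S.G b = S.G a' * S.x j * S.G b'"
        using eq by (simp add: v w mult.assoc)
      then have act: "(if int n dvd z + a then Some (pt n b)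
         else if int n dvd z + a - int i then Some (pt n (b - int i)) else None) =
        (if int n dvd z + a' then Some (pt n b')
         else if int n dvd z + a' - int j then Some (pt n (b' - int j)) else None)" for z
        using act_reflection [OF v(1), of a b z] act_reflection [OF w(1), of a' b' z] by simp
      have first: "int n dvd a' - a \<and> pt n b = pt n b' \<or> int n dvd a' - a - int j"
        using act [of "- a"] by (auto split: if_splits)
      have second: "int n dvd int i - a + a' \<or> int n dvd int i - a + a' - int j"
        using act [of "int i - a"] not_dvd(1) [OF v(1)] by (auto split: if_splits)
      have bounds: "1 \<le> i" "2 * i < n" "1 \<le> j" "2 * j < n"
        using v(1) w(1) two_m_less by auto
      \<comment> \<open>The domains {-a, i - a} and {-a', j - a'} cannot match with their points
        exchanged, since n would then divide i + j.\<close>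
      have "\<not> int n dvd a' - a - int j"
      proof
        assume *: "int n dvd a' - a - int j"
        from second have "int n dvd (int i - a + a') - (a' - a - int j) \<or>
            int n dvd (int i - a + a' - int j) - (a' - a - int j)"
          using * dvd_diff by blast
        then show False using nd [of "int i + int j"] nd [of "int i"] bounds by auto
      qed
      then have *: "int n dvd a' - a" "pt n b = pt n b'" using first by auto
      from second have "int n dvd (int i - a + a') - (a' - a) \<or>
          int n dvd (int i - a + a' - int j) - (a' - a)"
        using * dvd_diff by blast
      then have "int n dvd int i - int j"
        using nd [of "int i"] bounds by auto
      moreover have "\<bar>int i - int j\<bar> < int n" using bounds by linarith
      ultimately have "i = j" using nd [of "int i - int j"] by auto
      moreover have "T.G a' = T.G a" using * by (intro T.G_cong)
      moreover have "T.G b = T.G b'" using * by (intro T.G_cong) (simp add: pt_eq_iff [OF n_pos])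
      ultimately show ?thesis by (simp add: v w)
    qed
  qed
qed

lemma relations_in_lists: "set (relations n m) \<subseteq> lists (alphabet m) \<times> lists (alphabet m)"
proof -
  have pow: "w \<up> k \<in> lists (alphabet m)" if "w \<in> lists (alphabet m)" for w k
    using that by (auto simp: word_pow_def)
  have letters: "Gen_g \<in> alphabet m" "Gen_e1 \<in> alphabet m" "\<And>i. i \<in> {1..m} \<Longrightarrow> Gen_x i \<in> alphabet m"
    by (auto simp: alphabet_def)
  have "1 \<in> {1..m}" using n_ge_4 m_eq by auto
  then have "\<forall>(u, v)\<in>set (relations n m). u \<in> lists (alphabet m) \<and> v \<in> lists (alphabet m)"
    unfolding ball_relations_iff
    by (simp add: pow letters del: in_lists_conv_set)
  then show ?thesis by auto
qed

theorem defined_by_presentation_OPDI: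
  "defined_by_presentation (OPDI n) (alphabet m) (set (relations n m))"
proof -
  let ?A = "alphabet m"
  let ?Q = "set (relations n m)"
  let ?\<rho> = "generated_congruence (free_monoid ?A) ?Q"
  interpret S': relation_model n "point_action n" m by (rule relation_model)
  have cong: "monoid_congruence (free_monoid ?A) ?\<rho>"
    using relations_in_lists by (rule monoid_congruence_generated)
  let ?f = "regular_rep ?A ?\<rho>"
  note f_iff = word_val_regular_rep_eq_iff [OF cong]
  have f_relations: "satisfies_relations n m ?f"
    unfolding satisfies_relations_def
    using relations_in_lists generated_congruence_subset [of ?Q "free_monoid ?A"] f_iff by blast
  have "gw \<up> n \<in> lists ?A" by (auto simp: word_pow_def alphabet_def)
  moreover have "word_val ?f (gw \<up> n) = word_val ?f []"
    using f_relations unfolding satisfies_relations_def ball_relations_iff by blast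
  ultimately have model: "relation_model n ?f m"
    using n_pos n_ge_4 m_eq f_relations by unfold_locales auto
  \<comment> \<open>In this model equality of values is membership in the generated congruence, so
    the existence of normal forms holds for the presented monoid itself.\<close>
  interpret T: relation_model n ?f m by (rule model)
  have sound: "val u = val v" if "(u, v) \<in> ?\<rho>" for u v
  proof -
    have "?\<rho> \<subseteq> {(u, v). u \<in> lists ?A \<and> v \<in> lists ?A \<and> val u = val v}"
      using S'.relations_hold relations_in_lists
      by (intro generated_congruence_least monoid_congruence_kernel)
        (auto simp: satisfies_relations_def)
    then show ?thesis using that by blast
  qed
  have normal: "\<exists>v\<in>normal_words n m. (w, v) \<in> ?\<rho>" if "w \<in> lists ?A" for w
    using T.ex_normal_word [OF that] f_iff that normal_words_in_lists by blast
  have equiv: "equiv (lists ?A) ?\<rho>"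
    using cong by (simp add: monoid_congruence_free_monoid)
  \<comment> \<open>Equal action passes to the normal forms by soundness, there it forces equal
    values in the regular representation, and these mean congruence.\<close>
  have complete: "(u, v) \<in> ?\<rho>" if uv: "u \<in> lists ?A" "v \<in> lists ?A" "val u = val v" for u v
  proof -
    obtain u' v' where *: "u' \<in> normal_words n m" "(u, u') \<in> ?\<rho>"
      "v' \<in> normal_words n m" "(v, v') \<in> ?\<rho>"
      using normal uv by blast
    then have "val u' = val v'" using sound uv by metis
    then have "word_val ?f u' = word_val ?f v'"
      using word_val_eq_if_val_eq [OF model] * by blast
    then have "(u', v') \<in> ?\<rho>" using f_iff * normal_words_in_lists by blast
    then show ?thesis using * equiv unfolding equiv_def by (meson symD transD)
  qed
  have "OPDI n \<cong> quotient_monoid (free_monoid ?A) ?\<rho>"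
  proof (rule iso_quotient_monoidI [OF cong, of "\<lambda>w. partial_map n (val w)"])
    fix w assume "w \<in> lists ?A"
    then show "partial_map n (val w) \<in> carrier (OPDI n)"
      using normal sound normal_word_in_carrier_OPDI by metis
  next
    show "carrier (OPDI n) \<subseteq> (\<lambda>w. partial_map n (val w)) ` lists ?A"
      using carrier_OPDI_subset normal_words_in_lists by blast
  next
    fix u v assume uv: "u \<in> lists ?A" "v \<in> lists ?A"
    show "partial_map n (val (u @ v)) = partial_map n (val u) \<otimes>\<^bsub>OPDI n\<^esub> partial_map n (val v)"
      using partial_map_mult [OF proper_val proper_val] uv by (simp add: mult_OPDI)
    show "partial_map n (val u) = partial_map n (val v) \<longleftrightarrow> (u, v) \<in> ?\<rho>"
      using partial_map_inject [OF n_pos proper_val proper_val] sound complete uv by metis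
  qed
  then show ?thesis
    unfolding defined_by_presentation_def using relations_in_lists by blast
qed

end

section \<open>The number of letters and of relations\<close>

lemma card_alphabet: "card (alphabet m) = 2 + m"
proof -
  have "card (Gen_x ` {1..m}) = m" by (simp add: card_image inj_on_def)
  then show ?thesis by (simp add: alphabet_def image_iff)
qed

lemma sum_list_length_if:
  "(\<Sum>j\<leftarrow>xs. length (if P j then [h j] else [])) = length (filter P xs)"
  by (induction xs) auto

lemma length_filter_neq_upt:
  assumes "c \<in> {a..<b}"
  shows "length (filter (\<lambda>j. j \<noteq> c) [a..<b]) = b - a - 1"
proof -
  have "[a..<b] = [a..<c] @ c # [Suc c..<b]"
    using assms upt_split [of a c b] by (simp add: upt_conv_Cons)
  then show ?thesis using assms by simp
qed

lemma length_filter_less_upt: "length (filter (\<lambda>j. i < j) [1..<n + 1]) = n - i"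
  by (induction n) (auto simp: upt_Suc Suc_diff_le)

lemma double_sum_diff: "2 * (\<Sum>i\<in>{1..n}. n - i) + n = n * n" for n :: nat
proof -
  have "(\<Sum>i\<in>{1..n}. n - i) = (\<Sum>i<n. n - Suc i)"
    by (simp add: sum.atLeast1_atMost_eq One_nat_def)
  also have "\<dots> = (\<Sum>i<n. i)"
    by (rule sum.nat_diff_reindex)
  also have "2 * (\<Sum>i<n. i) + n = n * n"
    by (induction n) auto
  finally show ?thesis .
qed

text \<open>Three relations carry no parameter besides n, and the sum counts the pairs i < j. Each i
  in {1..m} contributes 2 + (n - 2) + (n - 2) + 2 + 1 = 2 n + 1, where the last 1 includes the
  separately listed square for i = 1.\<close>

lemma length_relations:
  assumes "n \<ge> 4" "m = (n - 1) div 2"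
  shows "length (relations n m) = 3 + (\<Sum>i\<in>{1..n}. n - i) + m * (2 * n + 1)"
proof -
  have const: "(\<Sum>i\<leftarrow>[1..<m + 1]. g i) = m * c" if "\<And>i. i \<in> {1..m} \<Longrightarrow> g i = c"
    for g :: "nat \<Rightarrow> nat" and c
    using that by (simp add: interv_sum_list_conv_sum_set_nat less_Suc_eq_le flip: Suc_eq_plus1)
  have pairs: "(\<Sum>i\<leftarrow>[1..<n + 1]. n - i) = (\<Sum>i\<in>{1..n}. n - i)"
    by (simp add: interv_sum_list_conv_sum_set_nat atLeastLessThanSuc_atLeastAtMost flip: Suc_eq_plus1)
  have "n + 1 - 2 - 1 = n - 2" by simp
  then have right: "(\<Sum>i\<leftarrow>[1..<m + 1]. length (filter (\<lambda>j. j \<noteq> n - i + 1) [2..<n + 1])) = m * (n - 2)"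
    and left: "(\<Sum>i\<leftarrow>[1..<m + 1]. length (filter (\<lambda>j. j \<noteq> i + 1) [2..<n + 1])) = m * (n - 2)"
    using assms by (intro const; subst length_filter_neq_upt; force)+
  have two: "(\<Sum>i\<leftarrow>[1..<m + 1]. Suc (Suc 0)) = m * 2" by (rule const) simp
  obtain k where k: "n = k + 2" using assms by (metis add.commute le_Suc_ex numeral_Bit0 order_trans le_add1)
  have "1 \<le> m" using assms by auto
  then show ?thesis
    unfolding relations_def
    by (simp add: length_concat o_def sum_list_length_if length_filter_less_upt pairs left right two)
      (simp add: k algebra_simps)
qed

lemma real_length_relations:
  assumes "n \<ge> 4" "m = (n - 1) div 2"
  shows "real (length (relations n m)) =
    1 / 2 * (3 * (real n)\<^sup>2 - (3 + (- 1) ^ n) * real n + 5 - (1 + (- 1) ^ n) / 2)"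
proof -
  have "2 * length (relations n m) + n = 6 + n * n + 2 * m * (2 * n + 1)"
    unfolding length_relations [OF assms] using double_sum_diff [of n] by simp
  then have "real (2 * length (relations n m) + n) = real (6 + n * n + 2 * m * (2 * n + 1))"
    by (simp only:)
  then have len: "2 * real (length (relations n m)) + real n =
      6 + real n * real n + 2 * real m * (2 * real n + 1)"
    by simp
  show ?thesis
  proof (cases "even n")
    case True
    then have "n = 2 * m + 2" using assms by (auto elim!: evenE)
    then have "real n = 2 * real m + 2" by simp
    moreover have "(- 1 :: real) ^ n = 1" using True by simp
    ultimately show ?thesis using len by (simp only:) (simp add: power2_eq_square field_simps)
  next
    case False
    then have "n = 2 * m + 1" using assms by (auto elim!: oddE)
    then have "real n = 2 * real m + 1" by simp
    moreover have "(- 1 :: real) ^ n = - 1" using False by simp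
    ultimately show ?thesis using len by (simp only:) (simp add: power2_eq_square field_simps)
  qed
qed

theorem theorem5p10:
  fixes n m :: nat
  assumes "n \<ge> 4" and "m = (n - 1) div 2"
  shows "card (alphabet m) = 2 + m \<and>
    real (length (relations n m)) =
      1 / 2 * (3 * (real n)\<^sup>2 - (3 + (- 1) ^ n) * real n + 5 - (1 + (- 1) ^ n) / 2) \<and>
    defined_by_presentation (OPDI n) (alphabet m) (set (relations n m))"
proof -
  interpret point_model n m by unfold_locales (use assms in auto)
  show ?thesis
    using card_alphabet real_length_relations [OF assms] defined_by_presentation_OPDI by blast
qed

end
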